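(* Let $p$ be an odd prime, $e\ge1$, and let $\mathcal M$ be an orientably-regular embedding of $K_{p[p^e]}$ with $G=\mathrm{Aut}^+(\mathcal M)$, $H$ the subgroup of $G$ of automorphisms preserving each of the $p$ parts setwise, and $P$ a Sylow $p$-subgroup of $G$. Let $f\in\{1,\dots,e\}$ be the integer such that $H\cong\langle x,z\mid x^{p^e}=z^{p^e}=1,\ z^x=z^{1+p^f}\rangle$. If $H$ is nonabelian and $P$ has exponent $p^e$, then $p=3$ and $f=e-1$.
   Context: $K_{m[n]}$ is the complete multipartite graph with $m$ parts of $n$ vertices each; an orientably-regular embedding of it is an orientable map with this underlying graph whose group $\mathrm{Aut}^+(\mathcal M)$ of orientation-preserving automorphisms acts regularly on arcs. It is known that in this situation $H$ is isomorphic to a group $\langle x,z\mid x^{p^e}=z^{p^e}=1,\ z^x=z^{1+p^f}\rangle$ for a unique $f\in\{1,\dots,e\}$ (different $f$ give non-isomorphic groups; $H$ is abelian iff $f=e$). Conjugation is $z^x=x^{-1}zx$. *)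

theory Defs
  imports "HOL-Algebra.Multiplicative_Group" "HOL-Computational_Algebra.Primes"
begin

(* ---------- Combinatorial oriented maps ----------
   An (orientable) map is given by a finite nonempty set D of darts (arcs) with
   a rotation R (permutation of D) and a fixed-point-free involution L of D
   (arc reversal), such that <R,L> acts transitively on D (connectedness).
   Vertices are the R-orbits, edges the L-orbits. *)

definition is_oriented_map :: "'d set \<Rightarrow> ('d \<Rightarrow> 'd) \<Rightarrow> ('d \<Rightarrow> 'd) \<Rightarrow> bool" where
  "is_oriented_map D R L \<longleftrightarrow>
     finite D \<and> D \<noteq> {} \<and>
     bij_betw R D D \<and> bij_betw L D D \<and>
     (\<forall>d\<in>D. L (L d) = d \<and> L d \<noteq> d) \<and>
     (\<forall>d\<in>D. \<forall>d'\<in>D. (d, d') \<in> ({(x, R x) | x. x \<in> D} \<union> {(x, L x) | x. x \<in> D})\<^sup>*)"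

(* Orientation-preserving automorphisms: permutations of D (identity outside D)
   commuting with R and L. *)
definition map_aut_set :: "'d set \<Rightarrow> ('d \<Rightarrow> 'd) \<Rightarrow> ('d \<Rightarrow> 'd) \<Rightarrow> ('d \<Rightarrow> 'd) set" where
  "map_aut_set D R L =
     {\<sigma>. bij_betw \<sigma> D D \<and> (\<forall>x. x \<notin> D \<longrightarrow> \<sigma> x = x) \<and>
          (\<forall>d\<in>D. \<sigma> (R d) = R (\<sigma> d) \<and> \<sigma> (L d) = L (\<sigma> d))}"

(* Aut^+(M) as a group (composition). *)
definition map_aut_group :: "'d set \<Rightarrow> ('d \<Rightarrow> 'd) \<Rightarrow> ('d \<Rightarrow> 'd) \<Rightarrow> ('d \<Rightarrow> 'd) monoid" where
  "map_aut_group D R L = \<lparr>carrier = map_aut_set D R L, monoid.mult = (\<lambda>\<sigma> \<tau>. \<sigma> \<circ> \<tau>), one = id\<rparr>"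

(* orientably-regular: Aut^+(M) acts regularly on the darts (arcs) *)
definition orientably_regular :: "'d set \<Rightarrow> ('d \<Rightarrow> 'd) \<Rightarrow> ('d \<Rightarrow> 'd) \<Rightarrow> bool" where
  "orientably_regular D R L \<longleftrightarrow>
     is_oriented_map D R L \<and>
     (\<forall>d\<in>D. \<forall>d'\<in>D. \<exists>!\<sigma>. \<sigma> \<in> map_aut_set D R L \<and> \<sigma> d = d')"

(* ---------- Underlying graph K_{m[n]} ----------
   K_{m[n]} has vertex set {0..<m} x {0..<n} (first coordinate = part), with
   (a,b) ~ (c,d) iff a \<noteq> c.  The map (D,R,L) has underlying graph K_{m[n]}
   via the vertex labelling nu (nu d = initial vertex of dart d) iff nu induces
   a bijection from R-orbits onto the vertices of K_{m[n]} and the edges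
   (L-orbits {d, L d}, joining nu d and nu (L d)) correspond bijectively to the
   edges of K_{m[n]} (no loops, no multiple edges). *)
definition underlying_Kmn :: "'d set \<Rightarrow> ('d \<Rightarrow> 'd) \<Rightarrow> ('d \<Rightarrow> 'd) \<Rightarrow> ('d \<Rightarrow> nat \<times> nat) \<Rightarrow> nat \<Rightarrow> nat \<Rightarrow> bool" where
  "underlying_Kmn D R L \<nu> m n \<longleftrightarrow>
     (\<forall>d\<in>D. \<forall>d'\<in>D. \<nu> d = \<nu> d' \<longleftrightarrow> (\<exists>k. (R ^^ k) d = d')) \<and>
     \<nu> ` D = {0..<m} \<times> {0..<n} \<and>
     (\<forall>d\<in>D. fst (\<nu> d) \<noteq> fst (\<nu> (L d))) \<and>
     (\<forall>u \<in> {0..<m} \<times> {0..<n}. \<forall>w \<in> {0..<m} \<times> {0..<n}. fst u \<noteq> fst w \<longrightarrow>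
        (\<exists>!d. d \<in> D \<and> \<nu> d = u \<and> \<nu> (L d) = w))"

(* The subgroup H of automorphisms preserving each part setwise *)
definition part_preserving :: "'d set \<Rightarrow> ('d \<Rightarrow> 'd) \<Rightarrow> ('d \<Rightarrow> 'd) \<Rightarrow> ('d \<Rightarrow> nat \<times> nat) \<Rightarrow> ('d \<Rightarrow> 'd) set" where
  "part_preserving D R L \<nu> = {\<sigma> \<in> map_aut_set D R L. \<forall>d\<in>D. fst (\<nu> (\<sigma> d)) = fst (\<nu> d)}"

(* ---------- Group-theoretic notions ---------- *)
definition sylow_subgroup :: "nat \<Rightarrow> 'a set \<Rightarrow> ('a, 'b) monoid_scheme \<Rightarrow> bool" where
  "sylow_subgroup p P G \<longleftrightarrow> subgroup P G \<and> card P = p ^ multiplicity p (order G)"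

(* exponent of a (finite) subgroup: lcm of the orders of its elements *)
definition group_exponent :: "('a, 'b) monoid_scheme \<Rightarrow> 'a set \<Rightarrow> nat" where
  "group_exponent G S = Lcm (group.ord G ` S)"

(* The metacyclic group <x,z | x^(p^e) = z^(p^e) = 1, x^-1 z x = z^(1+p^f)>,
   realised on normal forms x^i z^j (0 \<le> i,j < p^e) encoded as pairs (i,j):
   x^i z^j * x^k z^l = x^(i+k) z^(j*(1+p^f)^k + l). *)
definition metacyclic_group :: "nat \<Rightarrow> nat \<Rightarrow> nat \<Rightarrow> (nat \<times> nat) monoid" where
  "metacyclic_group p e f =
     \<lparr>carrier = {0..<p^e} \<times> {0..<p^e},
      monoid.mult = (\<lambda>(i, j) (k, l). ((i + k) mod p^e, (j * (1 + p^f)^k + l) mod p^e)),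
      one = (0, 0)\<rparr>"

end

theory Submission
  imports Defs "HOL-Number_Theory.Residues"
begin

text \<open>
  Let \<open>c \<in> P\<close> move some part; then \<open>c\<^sup>p \<in> H\<close>, and as \<open>P\<close> has exponent \<open>p\<^sup>e\<close>, the element \<open>c\<^sup>p\<close> has
  order at most \<open>p\<^sup>e\<^sup>-\<^sup>1\<close>. Write \<open>\<gamma>\<close> for conjugation by \<open>c\<close> on \<open>H\<close>, and \<open>\<gamma>(x) = x\<^sup>a z\<^sup>b\<close>,
  \<open>\<gamma>(z) = x\<^sup>s z\<^sup>t\<close>. The relation \<open>z x = x z\<^sup>q\<close> with \<open>q = 1 + p\<^sup>f\<close> forces \<open>p\<^sup>e\<^sup>-\<^sup>f\<close> to divide \<open>s\<close>, and
  \<open>\<gamma>\<^sup>p\<close>, being conjugation by \<open>c\<^sup>p\<close>, fixes \<open>x\<close> modulo \<open>p\<^sup>2\<close>-th powers. Expanding \<open>\<gamma>\<^sup>p(x)\<close> modulo \<open>p\<^sup>2\<close>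
  gives \<open>p b + (p choose 3) s b\<^sup>2 = 0 (mod p\<^sup>2)\<close>, hence \<open>p\<close> divides \<open>b\<close> unless \<open>p = 3\<close> and \<open>9\<close> does
  not divide \<open>s\<close>, which means \<open>f = e - 1\<close>.

  If \<open>p\<close> divides \<open>b\<close>, then \<open>h\<close> and \<open>\<gamma>(h)\<close> have the same \<open>p\<^sup>e\<^sup>-\<^sup>1\<close>-th power for all \<open>h \<in> H\<close>. The
  stabilizers in \<open>H\<close> of two adjacent vertices \<open>v\<close> and \<open>c v\<close> intersect trivially, so both are killed by
  \<open>p\<^sup>e\<^sup>-\<^sup>1\<close>; but each has order at least \<open>p\<^sup>e\<close>, so their product is all of \<open>H\<close>, which is not
  generated by elements of order at most \<open>p\<^sup>e\<^sup>-\<^sup>1\<close>.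
\<close>

section \<open>Congruences modulo the square of an odd prime\<close>

text \<open>Modulo \<open>p\<close> the recurrence matrix is unipotent and \<open>s\<close>
  vanishes, so modulo \<open>p^2\<close> there is an explicit solution: \<open>I n\<close> is linear
  in \<open>n\<close>, and \<open>J n\<close> is quadratic with top term
  \<open>(n choose 2) * s * b^2\<close>. Summing produces \<open>p choose 2\<close> times a multiple
  of \<open>p\<close>, and \<open>p choose 3\<close> times \<open>s\<close>. The latter binomial
  supplies a second factor \<open>p\<close> unless \<open>p = 3\<close>, which is where
  \<open>large\<close> enters.\<close>

lemma sum_linear_recurrence_cong:
  fixes I J :: "nat \<Rightarrow> int" and a b s t :: int and p :: nat
  assumes p: "prime p" "odd p"
    and a: "[a = 1] (mod p)" and t: "[t = 1] (mod p)" and s: "int p dvd s"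
    and large: "p \<noteq> 3 \<or> (int p)\<^sup>2 dvd s"
    and I0: "[a = 1 + I 0] (mod (int p)\<^sup>2)" and J0: "J 0 = b"
    and I_Suc: "\<And>n. [I (Suc n) = a * I n + s * J n] (mod (int p)\<^sup>2)"
    and J_Suc: "\<And>n. [J (Suc n) = b * I n + t * J n] (mod (int p)\<^sup>2)"
  shows "[(\<Sum>n<p. J n) = int p * b] (mod (int p)\<^sup>2)"
proof -
  define q where "q = int p"
  obtain \<alpha> where \<alpha>: "a = 1 + q * \<alpha>"
    using a unfolding q_def by (metis cong_iff_lin cong_sym)
  obtain \<tau> where \<tau>: "t = 1 + q * \<tau>"
    using t unfolding q_def by (metis cong_iff_lin cong_sym)
  obtain \<sigma> where \<sigma>: "s = q * \<sigma>"
    using s unfolding q_def by blast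
  \<comment> \<open>\<open>C\<close> is the part of \<open>J (Suc n) - J n\<close> that does not
    depend on \<open>n\<close>: it is \<open>b * I 0 + (t - 1) * b\<close> modulo
    \<open>q^2\<close>.\<close>
  define C where "C = b * q * \<alpha> + q * \<tau> * b"
  have q2: "q\<^sup>2 = q * q" by (simp add: power2_eq_square)
  have form: "(\<exists>k. I n = q * \<alpha> + int n * (s * b) + q\<^sup>2 * k) \<and>
       (\<exists>k. J n = b + int n * C + int (n choose 2) * (s * b\<^sup>2) + q\<^sup>2 * k)" for n
  proof (induction n)
    case 0
    from I0 have "[1 + q * \<alpha> = 1 + I 0] (mod q\<^sup>2)" unfolding \<alpha> q_def .
    then obtain k where "1 + I 0 = 1 + q * \<alpha> + q\<^sup>2 * k"
      by (auto simp: cong_iff_lin)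
    then have "I 0 = q * \<alpha> + q\<^sup>2 * k" by simp
    moreover have "J 0 = b + q\<^sup>2 * 0" using J0 by simp
    ultimately show ?case by (auto simp: binomial_eq_0)
  next
    case (Suc n)
    then obtain k l where k: "I n = q * \<alpha> + int n * (s * b) + q\<^sup>2 * k"
      and l: "J n = b + int n * C + int (n choose 2) * (s * b\<^sup>2) + q\<^sup>2 * l" by blast
    obtain k' where k': "I (Suc n) = a * I n + s * J n + q\<^sup>2 * k'"
      using I_Suc[of n] unfolding q_def[symmetric] by (metis cong_iff_lin cong_sym)
    obtain l' where l': "J (Suc n) = b * I n + t * J n + q\<^sup>2 * l'"
      using J_Suc[of n] unfolding q_def[symmetric] by (metis cong_iff_lin cong_sym)
    have ch: "int (Suc n choose 2) = int (n choose 2) + int n"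
      by (simp add: numeral_2_eq_2)
    \<comment> \<open>\<open>A\<close> is \<open>I n / q\<close> and \<open>B\<close> is
      \<open>(J n - b) / q\<close>; in these terms each product of two first-order quantities
      carries a visible factor \<open>q^2\<close>.\<close>
    define A where "A = \<alpha> + int n * (\<sigma> * b) + q * k"
    define B where "B = int n * (b * \<alpha> + \<tau> * b) + int (n choose 2) * (\<sigma> * b\<^sup>2) + q * l"
    have A: "I n = q * A"
      unfolding k A_def \<sigma> q2 by (simp add: algebra_simps)
    have B: "J n = b + q * B"
      unfolding l B_def C_def \<sigma> q2 by (simp add: algebra_simps)
    have "I (Suc n) = I n + s * b + q\<^sup>2 * (\<alpha> * A + \<sigma> * B + k')"
      unfolding k' \<alpha> \<sigma> B A q2 by (simp add: algebra_simps)
    then have 1: "I (Suc n) = q * \<alpha> + int (Suc n) * (s * b) + q\<^sup>2 * (k + \<alpha> * A + \<sigma> * B + k')"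
      unfolding k by (simp add: algebra_simps)
    have "J (Suc n) = J n + b * I n + q * \<tau> * J n + q\<^sup>2 * l'"
      unfolding l' \<tau> by (simp add: algebra_simps)
    also have "q * \<tau> * J n = q * \<tau> * b + q\<^sup>2 * (\<tau> * B)"
      unfolding B q2 by (simp add: algebra_simps)
    finally have "J (Suc n) = b + int (Suc n) * C + int (Suc n choose 2) * (s * b\<^sup>2)
        + q\<^sup>2 * (l + b * k + \<tau> * B + l')"
      unfolding l k C_def ch by (simp add: algebra_simps power2_eq_square[of b])
    then show ?case using 1 by blast
  qed
  then obtain k where
    k: "\<And>n. J n = b + int n * C + int (n choose 2) * (s * b\<^sup>2) + q\<^sup>2 * k n" by metis
  have "p > 2" using prime_ge_2_nat[OF p(1)] p(2) by (cases "p = 2") auto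
  have p2: "p dvd p choose 2"
    using \<open>p > 2\<close> p by (intro dvd_choose_prime) auto
  have s1: "(\<Sum>n<N. n) = N choose 2" for N
    by (induction N) (auto simp: numeral_2_eq_2)
  have s2: "(\<Sum>n<N. n choose 2) = N choose 3" for N
    by (induction N) (auto simp: numeral_2_eq_2 numeral_3_eq_3)
  have "(\<Sum>n<p. J n) = (\<Sum>n<p. b + int n * C + int (n choose 2) * (s * b\<^sup>2) + q\<^sup>2 * k n)"
    using k by simp
  also have "\<dots> = q * b + int (\<Sum>n<p. n) * C + int (\<Sum>n<p. n choose 2) * (s * b\<^sup>2)
      + q\<^sup>2 * (\<Sum>n<p. k n)"
    by (simp add: sum.distrib sum_distrib_left sum_distrib_right q_def)
  finally have S: "(\<Sum>n<p. J n) = q * b + int (p choose 2) * C + int (p choose 3) * (s * b\<^sup>2)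
      + q\<^sup>2 * (\<Sum>n<p. k n)" unfolding s1 s2 .
  have d1: "q\<^sup>2 dvd int (p choose 2) * C"
    unfolding q2 C_def using p2 by (intro mult_dvd_mono) (auto simp: q_def)
  have d2: "q\<^sup>2 dvd int (p choose 3) * (s * b\<^sup>2)"
  proof (cases "p = 3")
    case True
    then show ?thesis using large by (auto simp: q_def)
  next
    case False
    with \<open>p > 2\<close> have "p dvd p choose 3" by (intro dvd_choose_prime p) auto
    then show ?thesis unfolding q2 using s by (intro mult_dvd_mono) (auto simp: q_def)
  qed
  have "q\<^sup>2 dvd (\<Sum>n<p. J n) - q * b" unfolding S using d1 d2 by (simp add: dvd_add)
  then show ?thesis by (simp add: cong_iff_dvd_diff q_def)
qed

lemma one_plus_power: "\<exists>l. (1 + c) ^ n = 1 + c * int n + c\<^sup>2 * l" for c :: int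
proof (induction n)
  case (Suc n)
  then obtain l where "(1 + c) ^ n = 1 + c * int n + c\<^sup>2 * l" by blast
  then have "(1 + c) ^ Suc n = 1 + c * int (Suc n) + c\<^sup>2 * (int n + l + c * l)"
    by (simp add: algebra_simps power2_eq_square)
  then show ?case by blast
qed (auto intro: exI[of _ 0])

text \<open>To first order \<open>Q ^ k\<close> is \<open>1 + p * r * k\<close>. The linear terms
  add up to \<open>p * r * n * (n - 1) / 2\<close>, which \<open>p^2\<close> divides because
  \<open>p\<close> is odd and divides \<open>n\<close>.\<close>

lemma sum_powers_multiple_cong:
  fixes Q :: int and p n :: nat
  assumes "odd p" "[Q = 1] (mod p)" "p dvd n"
  shows "[(\<Sum>k<n. Q ^ k) = int n] (mod (int p)\<^sup>2)"
proof -
  obtain r where r: "Q = 1 + int p * r"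
    using assms(2) by (metis cong_iff_lin cong_sym)
  have "\<exists>l. Q ^ k = 1 + int p * r * int k + (int p)\<^sup>2 * l" for k
    using one_plus_power[of "int p * r" k] unfolding r power_mult_distrib by (metis mult.assoc)
  then obtain l where l: "\<And>k. Q ^ k = 1 + int p * r * int k + (int p)\<^sup>2 * l k" by metis
  have sum_id: "2 * (\<Sum>k<n. int k) = int n * (int n - 1)"
    by (induction n) (auto simp: algebra_simps)
  have "int p dvd 2 * (\<Sum>k<n. int k)" unfolding sum_id using assms(3) by simp
  moreover have "coprime (int p) 2" using assms(1) by simp
  ultimately have d: "int p dvd (\<Sum>k<n. int k)" by (simp add: coprime_dvd_mult_right_iff)
  have "(\<Sum>k<n. Q ^ k) - int n = int p * (\<Sum>k<n. int k) * r + (int p)\<^sup>2 * (\<Sum>k<n. l k)"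
    unfolding l by (simp add: sum.distrib sum_distrib_left sum_distrib_right mult_ac)
  moreover have "(int p)\<^sup>2 dvd int p * (\<Sum>k<n. int k) * r"
    using d by (auto simp: power2_eq_square)
  ultimately show ?thesis by (simp add: cong_iff_dvd_diff)
qed

text \<open>Cutting the range into \<open>p\<close> blocks of length \<open>p ^ m\<close> factors
  the sum into the same sum for \<open>m\<close> and a geometric sum of \<open>p\<close> terms in
  \<open>Q ^ p ^ m\<close>. The second factor is \<open>p\<close> modulo \<open>p^2\<close>, so each
  induction step gains one factor \<open>p\<close> and keeps one digit of precision.\<close>

lemma sum_powers_prime_power_cong:
  fixes Q :: int and p m :: nat
  assumes "odd p" "[Q = 1] (mod p)"
  shows "[(\<Sum>k<p ^ m. Q ^ k) = int p ^ m] (mod int p ^ Suc m)"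
proof (induction m)
  case 0 show ?case by simp
next
  case (Suc m)
  have split: "(\<Sum>k<n * l. Q ^ k) = (\<Sum>k<n. Q ^ k) * (\<Sum>i<l. (Q ^ n) ^ i)" for n l
  proof (induction l)
    case (Suc l)
    have "(\<Sum>k<n * Suc l. Q ^ k) = (\<Sum>k<n * l. Q ^ k) + (\<Sum>k<n. Q ^ (n * l + k))"
      using sum.atLeastLessThan_concat[of 0 "n * l" "n * Suc l" "\<lambda>k. Q ^ k"]
        sum.shift_bounds_nat_ivl[of "\<lambda>k. Q ^ k" 0 "n * l" n]
      by (simp add: atLeast0LessThan add.commute)
    also have "(\<Sum>k<n. Q ^ (n * l + k)) = (\<Sum>k<n. Q ^ k) * (Q ^ n) ^ l"
      by (simp add: power_add power_mult[symmetric] sum_distrib_right mult.commute)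
    finally show ?case
      unfolding Suc.IH by (simp add: distrib_left)
  qed simp
  obtain u where u: "(\<Sum>k<p ^ m. Q ^ k) = int p ^ m + int p ^ Suc m * u"
    using Suc by (metis cong_iff_lin cong_sym)
  have "[Q ^ p ^ m = 1] (mod p)" using cong_pow[OF assms(2), of "p ^ m"] by simp
  from sum_powers_multiple_cong[OF assms(1) this dvd_refl]
  obtain v where v: "(\<Sum>i<p. (Q ^ p ^ m) ^ i) = int p + (int p)\<^sup>2 * v"
    by (metis cong_iff_lin cong_sym)
  have "(\<Sum>k<p ^ Suc m. Q ^ k) = (int p ^ m + int p ^ Suc m * u) * (int p + (int p)\<^sup>2 * v)"
    using split[of "p ^ m" p] u v by (simp add: mult.commute)
  also have "\<dots> - int p ^ Suc m = int p ^ Suc (Suc m) * (v + u + int p * u * v)"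
    by (simp add: algebra_simps power2_eq_square)
  finally show ?case by (simp add: cong_iff_dvd_diff)
qed

section \<open>Endomorphisms of the metacyclic group\<close>

lemma one_plus_multiple_power_cong:
  fixes Q :: int and p n :: nat
  assumes "[Q = 1] (mod p)" "p dvd n"
  shows "[Q ^ n = 1] (mod (int p)\<^sup>2)"
proof -
  obtain r where r: "Q = 1 + int p * r"
    using assms(1) by (metis cong_iff_lin cong_sym)
  obtain l where "Q ^ n = 1 + int p * r * int n + (int p * r)\<^sup>2 * l"
    using one_plus_power[of "int p * r" n] unfolding r by blast
  moreover have "(int p)\<^sup>2 dvd int p * r * int n" "(int p)\<^sup>2 dvd (int p * r)\<^sup>2 * l"
    using assms(2) by (auto simp: power2_eq_square)
  ultimately show ?thesis by (simp add: cong_iff_dvd_diff dvd_add)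
qed

text \<open>Fermat: \<open>a ^ p\<close> and \<open>a\<close> agree modulo \<open>p\<close>. This
  recovers \<open>a\<close> and \<open>t\<close> modulo \<open>p\<close> from the
  \<open>p\<close>-th iterate of \<open>\<gamma>\<close>.\<close>

lemma prime_power_cong_oneD:
  fixes a p :: nat
  assumes "prime p" "[a ^ p = 1] (mod p)"
  shows "[a = 1] (mod p)"
proof (cases "p dvd a")
  case True
  then have "p dvd a ^ p"
    using assms(1) by (auto intro: dvd_trans dvd_power simp: prime_gt_0_nat)
  then show ?thesis
    using assms by (metis cong_dvd_iff nat_dvd_1_iff_1 not_prime_1)
next
  case False
  then have "[a ^ (p - 1) * a = 1 * a] (mod p)"
    using assms(1) by (intro cong_mult cong_refl fermat_theorem)
  moreover have "a ^ (p - 1) * a = a ^ p"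
    using assms(1) by (metis power_minus_mult prime_gt_0_nat)
  ultimately have "[a ^ p = a] (mod p)" by simp
  from cong_trans[OF cong_sym[OF this] assms(2)] show ?thesis .
qed

section \<open>Coordinate arithmetic in the nonabelian metacyclic group\<close>

locale odd_metacyclic =
  fixes p e f :: nat
  assumes prime_p: "prime p" and odd_p: "odd p" and f_pos: "1 \<le> f" and f_less: "f < e"
begin

abbreviation "M \<equiv> metacyclic_group p e f"
abbreviation "q \<equiv> 1 + p ^ f"

lemma carrier_M: "u \<in> carrier M \<longleftrightarrow> fst u < p ^ e \<and> snd u < p ^ e"
  by (cases u) (auto simp: metacyclic_group_def)

lemma mult_M:
  "u \<otimes>\<^bsub>M\<^esub> v = ((fst u + fst v) mod p ^ e, (snd u * q ^ fst v + snd v) mod p ^ e)"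
  by (cases u; cases v) (simp add: metacyclic_group_def)

lemma one_M: "\<one>\<^bsub>M\<^esub> = (0, 0)"
  by (simp add: metacyclic_group_def)

lemma p_gt_1: "p > 1" using prime_p by (rule prime_gt_1_nat)

lemma pe_pos: "p ^ e > 0" using p_gt_1 by simp

text \<open>A further factor \<open>u\<close> on the right multiplies the exponent of
  \<open>z\<close> collected so far by \<open>q ^ fst u\<close> before \<open>snd u\<close> is
  added. Iterating this is Horner's scheme for a geometric sum.\<close>

lemma pow_M:
  "u [^]\<^bsub>M\<^esub> n = (fst u * n mod p ^ e, snd u * (\<Sum>k<n. (q ^ fst u) ^ k) mod p ^ e)"
proof (induction n)
  case (Suc n)
  have "(\<Sum>k<Suc n. (q ^ fst u) ^ k) = (\<Sum>k<n. (q ^ fst u) ^ k) * q ^ fst u + 1"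
    by (subst sum.lessThan_Suc_shift) (simp add: sum_distrib_left mult.commute)
  then have S: "snd u * (\<Sum>k<Suc n. (q ^ fst u) ^ k) = snd u * (\<Sum>k<n. (q ^ fst u) ^ k) * q ^ fst u + snd u"
    by (simp add: algebra_simps)
  show ?case
    unfolding nat_pow_Suc Suc mult_M S fst_conv snd_conv mult_Suc_right
    by (simp only: mod_add_right_eq mod_mod_trivial add.commute[of _ "fst u"]
        mod_add_cong[OF mod_mult_left_eq refl])
qed (simp add: one_M)

lemma pow_closed_M: "u [^]\<^bsub>M\<^esub> (n::nat) \<in> carrier M"
  using pe_pos by (simp add: carrier_M pow_M)

text \<open>With this, multiplicative maps are seen to preserve the identity without first proving
  that \<open>M\<close> is a group.\<close>

lemma idempotent_M:
  assumes "u \<in> carrier M" "u \<otimes>\<^bsub>M\<^esub> u = u"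
  shows "u = \<one>\<^bsub>M\<^esub>"
proof -
  have "[fst u + fst u = fst u] (mod p ^ e)"
    using arg_cong[OF assms(2), of fst] by (simp add: mult_M cong_def) (metis mod_mod_trivial)
  then have "[fst u = 0] (mod p ^ e)" by (simp add: cong_add_lcancel_0_nat)
  then have 1: "fst u = 0" using assms(1) by (simp add: carrier_M cong_def)
  have "[snd u + snd u = snd u] (mod p ^ e)"
    using arg_cong[OF assms(2), of snd] 1 by (simp add: mult_M cong_def) (metis mod_mod_trivial)
  then have "[snd u = 0] (mod p ^ e)" by (simp add: cong_add_lcancel_0_nat)
  then have "snd u = 0" using assms(1) by (simp add: carrier_M cong_def)
  with 1 show ?thesis by (simp add: one_M prod_eq_iff)
qed

lemma q_cong: "[int q = 1] (mod p)"
  using f_pos by (simp add: cong_iff_dvd_diff)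

lemma q_pow_cong: "[int q ^ n = 1] (mod p)"
  using cong_pow[OF q_cong, of n] by simp

lemma cong_p: "[a = b] (mod int (p ^ e)) \<Longrightarrow> [a = b] (mod int p)"
  using f_less by (auto intro: cong_dvd_modulus)

text \<open>Here \<open>e\<close> is at least 2, because \<open>1 \<le> f < e\<close>.\<close>

lemma cong_p2: "[a = b] (mod int (p ^ e)) \<Longrightarrow> [a = b] (mod (int p)\<^sup>2)"
  using f_less f_pos by (erule_tac cong_dvd_modulus) (auto intro: le_imp_power_dvd)

lemma fst_mult: "[int (fst (u \<otimes>\<^bsub>M\<^esub> v)) = int (fst u) + int (fst v)] (mod int (p ^ e))"
  by (simp add: mult_M cong_def zmod_int)

lemma snd_mult:
  "[int (snd (u \<otimes>\<^bsub>M\<^esub> v)) = int (snd u) * int q ^ fst v + int (snd v)] (mod int (p ^ e))"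
  by (simp add: mult_M cong_def zmod_int)

lemma fst_pow: "[int (fst (u [^]\<^bsub>M\<^esub> n)) = int (fst u) * int n] (mod int (p ^ e))"
  by (simp add: pow_M cong_def zmod_int)

lemma snd_pow:
  "[int (snd (u [^]\<^bsub>M\<^esub> n)) = int (snd u) * (\<Sum>k<n. (int q ^ fst u) ^ k)] (mod int (p ^ e))"
  by (simp add: pow_M cong_def zmod_int)

lemma snd_mult_p: "[int (snd (u \<otimes>\<^bsub>M\<^esub> v)) = int (snd u) + int (snd v)] (mod int p)"
proof -
  have "[int (snd u) * int q ^ fst v + int (snd v) = int (snd u) * 1 + int (snd v)] (mod int p)"
    by (intro cong_add cong_mult cong_refl q_pow_cong)
  from cong_trans[OF cong_p[OF snd_mult] this] show ?thesis by simp
qed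

text \<open>The twist \<open>q ^ fst v\<close> is always 1 modulo \<open>p\<close>, but it is 1
  modulo \<open>p^2\<close> once its exponent is a multiple of \<open>p\<close>. This is the source
  of every divisibility condition on first coordinates below.\<close>

lemma snd_mult_p2:
  assumes "p dvd fst v"
  shows "[int (snd (u \<otimes>\<^bsub>M\<^esub> v)) = int (snd u) + int (snd v)] (mod (int p)\<^sup>2)"
proof -
  have "[int (snd u) * int q ^ fst v + int (snd v) = int (snd u) * 1 + int (snd v)] (mod (int p)\<^sup>2)"
    by (intro cong_add cong_mult cong_refl one_plus_multiple_power_cong q_cong assms)
  from cong_trans[OF cong_p2[OF snd_mult] this] show ?thesis by simp
qed

text \<open>The geometric sum of length \<open>p ^ (e - 1)\<close> collapses to its length modulo
  \<open>p ^ e\<close>, so this power map acts coordinatewise although \<open>M\<close> is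
  nonabelian.\<close>

lemma p_power_M:
  "u [^]\<^bsub>M\<^esub> (p ^ (e - 1)) = (fst u * p ^ (e - 1) mod p ^ e, snd u * p ^ (e - 1) mod p ^ e)"
proof -
  have "[(\<Sum>k<p ^ (e - 1). (int q ^ fst u) ^ k) = int p ^ (e - 1)] (mod int p ^ Suc (e - 1))"
    by (intro sum_powers_prime_power_cong odd_p q_pow_cong)
  moreover have "Suc (e - 1) = e" using f_less by simp
  ultimately have "[int (\<Sum>k<p ^ (e - 1). (q ^ fst u) ^ k) = int (p ^ (e - 1))] (mod int (p ^ e))"
    by simp
  then have "[(\<Sum>k<p ^ (e - 1). (q ^ fst u) ^ k) = p ^ (e - 1)] (mod p ^ e)"
    unfolding cong_int_iff .
  then have "[snd u * (\<Sum>k<p ^ (e - 1). (q ^ fst u) ^ k) = snd u * p ^ (e - 1)] (mod p ^ e)"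
    by (intro cong_mult cong_refl)
  then show ?thesis by (simp only: pow_M cong_def)
qed

lemma mult_p_power_cong_iff:
  "a * p ^ (e - 1) mod p ^ e = b * p ^ (e - 1) mod p ^ e \<longleftrightarrow> [a = b] (mod p)"
proof -
  have "p ^ e = p * p ^ (e - 1)" using f_less by (cases e) auto
  then show ?thesis using p_gt_1 by (simp add: cong_def mult_mod_left[symmetric])
qed

text \<open>Multiplication by \<open>p ^ (e - 1)\<close> modulo \<open>p ^ e\<close> sees only
  residues modulo \<open>p\<close>. Comparing such powers thus becomes linear algebra modulo
  \<open>p\<close>.\<close>

lemma p_power_M_eq_iff:
  "u [^]\<^bsub>M\<^esub> (p ^ (e - 1)) = v [^]\<^bsub>M\<^esub> (p ^ (e - 1)) \<longleftrightarrow>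
    [fst u = fst v] (mod p) \<and> [snd u = snd v] (mod p)"
  unfolding p_power_M prod.inject mult_p_power_cong_iff ..

end

section \<open>Endomorphisms and their iterates modulo \<open>p\<close> and
  \<open>p^2\<close>\<close>

locale metacyclic_endomorphism = odd_metacyclic +
  fixes \<gamma> :: "nat \<times> nat \<Rightarrow> nat \<times> nat"
  assumes closed: "u \<in> carrier M \<Longrightarrow> \<gamma> u \<in> carrier M"
    and hom: "u \<in> carrier M \<Longrightarrow> v \<in> carrier M \<Longrightarrow> \<gamma> (u \<otimes>\<^bsub>M\<^esub> v) = \<gamma> u \<otimes>\<^bsub>M\<^esub> \<gamma> v"
begin

text \<open>The pairs \<open>(1, 0)\<close> and \<open>(0, 1)\<close> encode the generators
  \<open>x\<close> and \<open>z\<close>.\<close>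

definition "a = fst (\<gamma> (1, 0))"
definition "b = snd (\<gamma> (1, 0))"
definition "s = fst (\<gamma> (0, 1))"
definition "t = snd (\<gamma> (0, 1))"

lemma generators_in_M: "(1, 0) \<in> carrier M" "(0, 1) \<in> carrier M" "(0, 0) \<in> carrier M"
  using one_less_power[OF p_gt_1, of e] f_less p_gt_1 by (auto simp: carrier_M)

lemma map_one: "\<gamma> (0, 0) = (0, 0)"
proof -
  have "\<gamma> (0, 0) \<otimes>\<^bsub>M\<^esub> \<gamma> (0, 0) = \<gamma> (0, 0)"
    using hom[of "(0, 0)" "(0, 0)"] generators_in_M by (simp add: mult_M)
  then show ?thesis using idempotent_M closed generators_in_M one_M by metis
qed

lemma map_pow: "u \<in> carrier M \<Longrightarrow> \<gamma> (u [^]\<^bsub>M\<^esub> n) = \<gamma> u [^]\<^bsub>M\<^esub> (n::nat)"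
  by (induction n) (simp_all add: map_one[folded one_M] hom pow_closed_M)

lemma map_normal_form:
  assumes "u \<in> carrier M"
  shows "\<gamma> u = \<gamma> (1, 0) [^]\<^bsub>M\<^esub> fst u \<otimes>\<^bsub>M\<^esub> \<gamma> (0, 1) [^]\<^bsub>M\<^esub> snd u"
proof -
  have "(1, 0) [^]\<^bsub>M\<^esub> fst u \<otimes>\<^bsub>M\<^esub> (0, 1) [^]\<^bsub>M\<^esub> snd u = u"
    using assms by (simp add: carrier_M mult_M pow_M prod_eq_iff)
  then show ?thesis by (metis hom map_pow pow_closed_M generators_in_M(1,2))
qed

lemma fst_map:
  assumes "u \<in> carrier M"
  shows "[int (fst (\<gamma> u)) = int a * int (fst u) + int s * int (snd u)] (mod int (p ^ e))"
  unfolding map_normal_form[OF assms] a_def s_def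
  by (rule cong_trans[OF fst_mult]) (intro cong_add fst_pow)

lemma snd_map_p:
  assumes "u \<in> carrier M"
  shows "[int (snd (\<gamma> u)) = int b * int (fst u) + int t * int (snd u)] (mod int p)"
proof -
  have *: "[int (snd (v [^]\<^bsub>M\<^esub> n)) = int (snd v) * int n] (mod int p)" for v n
  proof -
    have "[(\<Sum>k<n. (int q ^ fst v) ^ k) = (\<Sum>k<n. 1)] (mod int p)"
      unfolding power_mult[symmetric] by (intro cong_sum q_pow_cong)
    then have "[int (snd v) * (\<Sum>k<n. (int q ^ fst v) ^ k) = int (snd v) * int n] (mod int p)"
      by (intro cong_mult cong_refl) simp
    from cong_trans[OF cong_p[OF snd_pow] this] show ?thesis .
  qed
  show ?thesis
    unfolding map_normal_form[OF assms] b_def t_def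
    by (rule cong_trans[OF snd_mult_p]) (intro cong_add *)
qed

text \<open>The image of \<open>z x = x z\<^sup>q\<close> in the abelian first coordinate.\<close>

lemma s_dvd: "p ^ (e - f) dvd s"
proof -
  have "(0, 1) \<otimes>\<^bsub>M\<^esub> (1, 0) = (1, 0) \<otimes>\<^bsub>M\<^esub> (0, 1) [^]\<^bsub>M\<^esub> q"
    by (simp add: mult_M pow_M mod_simps)
  then have "\<gamma> (0, 1) \<otimes>\<^bsub>M\<^esub> \<gamma> (1, 0) = \<gamma> (1, 0) \<otimes>\<^bsub>M\<^esub> \<gamma> (0, 1) [^]\<^bsub>M\<^esub> q"
    by (metis generators_in_M(1,2) hom map_pow pow_closed_M)
  then have "(s + a) mod p ^ e = (a + s * q mod p ^ e) mod p ^ e"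
    unfolding mult_M pow_M prod.inject fst_conv a_def s_def by (rule conjunct1)
  then have "[a + s + 0 = a + s + s * p ^ f] (mod p ^ e)"
    unfolding cong_def mod_add_right_eq by (simp add: algebra_simps)
  then have "[0 = s * p ^ f] (mod p ^ e)" unfolding cong_add_lcancel_nat .
  then have "p ^ e dvd s * p ^ f" using cong_0_iff cong_sym by blast
  moreover have "p ^ e = p ^ (e - f) * p ^ f" using f_less by (simp flip: power_add)
  ultimately show ?thesis using p_gt_1 by simp
qed

lemma p_dvd_s: "p dvd s"
  using s_dvd f_less by (meson dvd_trans dvd_power zero_less_diff)

lemma fst_map_p:
  assumes "u \<in> carrier M"
  shows "[int (fst (\<gamma> u)) = int a * int (fst u)] (mod int p)"
proof -
  have "[int a * int (fst u) + int s * int (snd u) = int a * int (fst u) + 0] (mod int p)"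
    using p_dvd_s by (intro cong_add cong_refl) (simp add: cong_0_iff)
  from cong_trans[OF cong_p[OF fst_map[OF assms]] this] show ?thesis by simp
qed

text \<open>Both geometric sums reduce to their lengths modulo \<open>p^2\<close>, for different
  reasons: for the power of \<open>\<gamma> (1, 0)\<close> the length \<open>fst u\<close> is a
  multiple of \<open>p\<close>, and for the power of \<open>\<gamma> (0, 1)\<close> each summand is
  1 since \<open>p\<close> divides \<open>s\<close>. The latter divisibility also removes the twist
  in the product.\<close>

lemma snd_map_p2:
  assumes u: "u \<in> carrier M" and dvd: "p dvd fst u"
  shows "[int (snd (\<gamma> u)) = int b * int (fst u) + int t * int (snd u)] (mod (int p)\<^sup>2)"
proof -
  have "int p dvd int (fst (\<gamma> (0, 1) [^]\<^bsub>M\<^esub> snd u))"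
  proof -
    have "[int (fst (\<gamma> (0, 1) [^]\<^bsub>M\<^esub> snd u)) = int s * int (snd u)] (mod int p)"
      unfolding s_def by (rule cong_p[OF fst_pow])
    then show ?thesis using p_dvd_s by (metis cong_dvd_iff dvd_mult2 int_dvd_int_iff)
  qed
  then have 1: "p dvd fst (\<gamma> (0, 1) [^]\<^bsub>M\<^esub> snd u)" by simp
  have "[(\<Sum>k<fst u. (int q ^ a) ^ k) = int (fst u)] (mod (int p)\<^sup>2)"
    by (intro sum_powers_multiple_cong odd_p q_pow_cong dvd)
  then have "[int b * (\<Sum>k<fst u. (int q ^ a) ^ k) = int b * int (fst u)] (mod (int p)\<^sup>2)"
    by (intro cong_mult cong_refl)
  then have 2: "[int (snd (\<gamma> (1, 0) [^]\<^bsub>M\<^esub> fst u)) = int b * int (fst u)] (mod (int p)\<^sup>2)"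
    using cong_p2[OF snd_pow[of "\<gamma> (1, 0)" "fst u"]] cong_trans unfolding a_def b_def by blast
  have "[(\<Sum>k<snd u. (int q ^ s) ^ k) = (\<Sum>k<snd u. 1)] (mod (int p)\<^sup>2)"
    unfolding power_mult[symmetric] using p_dvd_s
    by (intro cong_sum one_plus_multiple_power_cong q_cong) simp
  then have "[int t * (\<Sum>k<snd u. (int q ^ s) ^ k) = int t * int (snd u)] (mod (int p)\<^sup>2)"
    by (intro cong_mult cong_refl) simp
  then have 3: "[int (snd (\<gamma> (0, 1) [^]\<^bsub>M\<^esub> snd u)) = int t * int (snd u)] (mod (int p)\<^sup>2)"
    using cong_p2[OF snd_pow[of "\<gamma> (0, 1)" "snd u"]] cong_trans unfolding s_def t_def by blast
  show ?thesis
    unfolding map_normal_form[OF u]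
    by (rule cong_trans[OF snd_mult_p2[OF 1]]) (intro cong_add 2 3)
qed

lemma iterate_closed: "u \<in> carrier M \<Longrightarrow> (\<gamma> ^^ n) u \<in> carrier M"
  by (induction n) (auto intro: closed)

lemma iterate_hom:
  "u \<in> carrier M \<Longrightarrow> v \<in> carrier M \<Longrightarrow> (\<gamma> ^^ n) (u \<otimes>\<^bsub>M\<^esub> v) = (\<gamma> ^^ n) u \<otimes>\<^bsub>M\<^esub> (\<gamma> ^^ n) v"
  by (induction n) (auto simp: hom iterate_closed)

lemma fst_iterate_p:
  assumes "u \<in> carrier M"
  shows "[int (fst ((\<gamma> ^^ n) u)) = int a ^ n * int (fst u)] (mod int p)"
proof (induction n)
  case (Suc n)
  have "[int a * int (fst ((\<gamma> ^^ n) u)) = int a * (int a ^ n * int (fst u))] (mod int p)"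
    by (intro cong_mult cong_refl Suc)
  from cong_trans[OF fst_map_p[OF iterate_closed[OF assms]] this] show ?case
    by (simp add: mult.assoc)
qed simp

text \<open>The first coordinate stays divisible by \<open>p\<close> under iteration, so
  \<open>b\<close> never contributes and each step only multiplies by \<open>t\<close>.\<close>

lemma snd_iterate_p:
  assumes "u \<in> carrier M" "p dvd fst u"
  shows "[int (snd ((\<gamma> ^^ n) u)) = int t ^ n * int (snd u)] (mod int p)"
proof (induction n)
  case (Suc n)
  have "int p dvd int (fst ((\<gamma> ^^ n) u))"
    using fst_iterate_p[OF assms(1), of n] assms(2)
    by (metis cong_dvd_iff dvd_mult int_dvd_int_iff)
  then have "[int b * int (fst ((\<gamma> ^^ n) u)) + int t * int (snd ((\<gamma> ^^ n) u))
      = 0 + int t * (int t ^ n * int (snd u))] (mod int p)"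
    by (intro cong_add cong_mult cong_refl Suc) (simp add: cong_0_iff)
  from cong_trans[OF snd_map_p[OF iterate_closed[OF assms(1)]] this] show ?case
    by (simp add: mult.assoc)
qed simp

end

text \<open>The element \<open>m\<close> stands for the image of \<open>c\<^sup>p\<close>. Condition
  \<open>inner\<close> says that \<open>\<gamma>\<^sup>p\<close> is conjugation by \<open>m\<close>,
  written without inverses; \<open>m_dvd\<close> reflects that \<open>m\<close> is killed by
  \<open>p ^ (e - 1)\<close>.\<close>

locale metacyclic_inner_power = metacyclic_endomorphism +
  fixes m :: "nat \<times> nat"
  assumes m_dvd: "p dvd fst m" "p dvd snd m"
    and inner: "u \<in> carrier M \<Longrightarrow> (\<gamma> ^^ p) u \<otimes>\<^bsub>M\<^esub> m = m \<otimes>\<^bsub>M\<^esub> u"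
    and not_exceptional: "\<not> (p = 3 \<and> f = e - 1)"
begin

lemma fst_iterate_inner:
  assumes "u \<in> carrier M"
  shows "[int (fst ((\<gamma> ^^ p) u)) = int (fst u)] (mod int p)"
proof -
  have "[int (fst ((\<gamma> ^^ p) u)) + int (fst m) = int (fst m) + int (fst u)] (mod int p)"
    using cong_p[OF fst_mult[of "(\<gamma> ^^ p) u" m]] cong_p[OF fst_mult[of m u]] inner[OF assms]
    by (metis cong_sym cong_trans)
  then show ?thesis by (simp add: add.commute cong_add_lcancel)
qed

lemma snd_iterate_inner:
  assumes "u \<in> carrier M"
  shows "[int (snd ((\<gamma> ^^ p) u)) = int (snd u)] (mod int p)"
proof -
  have "[int (snd ((\<gamma> ^^ p) u)) + int (snd m) = int (snd m) + int (snd u)] (mod int p)"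
    using snd_mult_p[of "(\<gamma> ^^ p) u" m] snd_mult_p[of m u] inner[OF assms]
    by (metis cong_sym cong_trans)
  then show ?thesis by (simp add: add.commute cong_add_lcancel)
qed

text \<open>Conjugation is invisible in coordinates modulo \<open>p\<close>, whereas
  \<open>\<gamma>\<^sup>p\<close> multiplies the first coordinate by \<open>a ^ p\<close>. The same
  comparison at \<open>(0, 1)\<close> gives \<open>t_cong\<close>.\<close>

lemma a_cong: "[a = 1] (mod p)"
proof -
  have "[int a ^ p = 1] (mod int p)"
    using fst_iterate_p[of "(1, 0)" p] fst_iterate_inner[of "(1, 0)"] generators_in_M
    by simp (metis cong_sym cong_trans)
  then have "[a ^ p = 1] (mod p)" by (simp flip: cong_int_iff)
  then show ?thesis using prime_p by (rule_tac prime_power_cong_oneD)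
qed

lemma t_cong: "[t = 1] (mod p)"
proof -
  have "[int t ^ p = 1] (mod int p)"
    using snd_iterate_p[of "(0, 1)" p] snd_iterate_inner[of "(0, 1)"] generators_in_M
    by simp (metis cong_sym cong_trans)
  then have "[t ^ p = 1] (mod p)" by (simp flip: cong_int_iff)
  then show ?thesis using prime_p by (rule_tac prime_power_cong_oneD)
qed

text \<open>Writing \<open>\<gamma>(x) = x y\<close> gives \<open>\<gamma>\<^sup>n(x) = x y
  \<gamma>(y) ... \<gamma>\<^sup>n\<^sup>-\<^sup>1(y)\<close>. All factors after \<open>x\<close>
  have first coordinate divisible by \<open>p\<close>, so second coordinates add modulo
  \<open>p^2\<close>, and for \<open>n = p\<close> their sum is \<open>p * b\<close>. Conjugation by
  \<open>m\<close>, on the other hand, leaves the second coordinate of \<open>x\<close> at 0 modulo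
  \<open>p^2\<close>.\<close>

lemma p_dvd_b: "p dvd b"
proof -
  \<comment> \<open>This is the inverse of \<open>x\<close> times \<open>\<gamma>(x)\<close>; the
    natural subtraction is exact because \<open>a\<close> is nonzero, being 1 modulo
    \<open>p\<close>.\<close>
  define y where "y = (a - 1, b)"
  have \<gamma>x: "\<gamma> (1, 0) \<in> carrier M" "\<gamma> (1, 0) = (a, b)"
    using closed generators_in_M by (auto simp: a_def b_def)
  have "a \<noteq> 0" using a_cong p_gt_1 by (intro notI) (simp add: cong_def)
  then have y: "y \<in> carrier M" and xy: "\<gamma> (1, 0) = (1, 0) \<otimes>\<^bsub>M\<^esub> y"
    using \<gamma>x by (auto simp: y_def carrier_M mult_M)
  define I where "I n = int (fst ((\<gamma> ^^ n) y))" for n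
  define J where "J n = int (snd ((\<gamma> ^^ n) y))" for n
  have "p dvd fst y"
    using a_cong \<open>a \<noteq> 0\<close> by (simp add: y_def cong_altdef_nat)
  then have I_dvd: "p dvd fst ((\<gamma> ^^ n) y)" for n
    using fst_iterate_p[OF y, of n] by (metis cong_dvd_iff dvd_mult int_dvd_int_iff)
  have "[(\<Sum>n<p. J n) = int p * int b] (mod (int p)\<^sup>2)"
  proof (rule sum_linear_recurrence_cong[of p "int a" "int t" "int s" I])
    show "prime p" "odd p" by (fact prime_p odd_p)+
    show "[int a = 1] (mod int p)" "[int t = 1] (mod int p)"
      using a_cong t_cong by (simp_all flip: cong_int_iff)
    show "int p dvd int s" using p_dvd_s by simp
    show "p \<noteq> 3 \<or> (int p)\<^sup>2 dvd int s"
    proof (cases "p = 3")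
      case True
      then have "2 \<le> e - f" using not_exceptional f_less by auto
      then have "p\<^sup>2 dvd s" using s_dvd by (meson dvd_trans le_imp_power_dvd)
      then show ?thesis by (metis of_nat_dvd_iff of_nat_power)
    qed simp
    show "[int a = 1 + I 0] (mod (int p)\<^sup>2)"
      using \<open>a \<noteq> 0\<close> by (simp add: I_def y_def of_nat_diff)
    show "J 0 = int b" by (simp add: J_def y_def)
    show "[I (Suc n) = int a * I n + int s * J n] (mod (int p)\<^sup>2)" for n
      using cong_p2[OF fst_map[OF iterate_closed[OF y, of n]]] by (simp add: I_def J_def)
    show "[J (Suc n) = int b * I n + int t * J n] (mod (int p)\<^sup>2)" for n
      using snd_map_p2[OF iterate_closed[OF y] I_dvd, of n] by (simp add: I_def J_def)
  qed
  moreover have "[int (snd ((\<gamma> ^^ n) (1, 0))) = (\<Sum>k<n. J k)] (mod (int p)\<^sup>2)" for n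
  proof (induction n)
    case (Suc n)
    have "(\<gamma> ^^ Suc n) (1, 0) = (\<gamma> ^^ n) (1, 0) \<otimes>\<^bsub>M\<^esub> (\<gamma> ^^ n) y"
      using xy iterate_hom[OF generators_in_M(1) y] by (simp add: funpow_Suc_right del: funpow.simps)
    then have "[int (snd ((\<gamma> ^^ Suc n) (1, 0))) = int (snd ((\<gamma> ^^ n) (1, 0))) + J n] (mod (int p)\<^sup>2)"
      using snd_mult_p2[OF I_dvd] by (simp add: J_def)
    moreover have "[int (snd ((\<gamma> ^^ n) (1, 0))) + J n = (\<Sum>k<n. J k) + J n] (mod (int p)\<^sup>2)"
      by (intro cong_add cong_refl Suc)
    ultimately show ?case using cong_trans by (simp only: sum.lessThan_Suc)
  qed simp
  moreover have "[int (snd ((\<gamma> ^^ p) (1, 0))) = 0] (mod (int p)\<^sup>2)"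
  proof -
    let ?g = "(\<gamma> ^^ p) (1, 0)"
    have "[int (snd ?g) + int (snd m) = int (snd (?g \<otimes>\<^bsub>M\<^esub> m))] (mod (int p)\<^sup>2)"
      using m_dvd by (intro cong_sym[OF snd_mult_p2])
    also have "?g \<otimes>\<^bsub>M\<^esub> m = m \<otimes>\<^bsub>M\<^esub> (1, 0)"
      by (intro inner generators_in_M)
    also have "[int (snd (m \<otimes>\<^bsub>M\<^esub> (1, 0))) = int (snd m) * int q] (mod (int p)\<^sup>2)"
      using cong_p2[OF snd_mult[of m "(1, 0)"]] by simp
    \<comment> \<open>Moving \<open>x\<close> past \<open>m\<close> changes the exponent of
      \<open>z\<close> by \<open>snd m * p ^ f\<close>, a multiple of \<open>p^2\<close> since
      \<open>p\<close> divides both factors.\<close>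
    also have "int (snd m) * int q = int (snd m) + int (snd m * p ^ f)"
      by (simp add: algebra_simps)
    also have "[int (snd m) + int (snd m * p ^ f) = int (snd m) + 0] (mod (int p)\<^sup>2)"
    proof (intro cong_add cong_refl)
      have "p * p dvd snd m * p ^ f"
        using m_dvd f_pos by (intro mult_dvd_mono) auto
      then show "[int (snd m * p ^ f) = 0] (mod (int p)\<^sup>2)"
        by (metis cong_0_iff of_nat_dvd_iff of_nat_mult power2_eq_square)
    qed
    finally show ?thesis by (simp add: add.commute cong_add_lcancel_0)
  qed
  ultimately have "[int p * int b = 0] (mod (int p)\<^sup>2)"
    by (metis cong_sym cong_trans)
  then show ?thesis using p_gt_1 by (simp add: cong_0_iff power2_eq_square)
qed

text \<open>Modulo \<open>p\<close> the matrix of \<open>\<gamma>\<close> is now the identity: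
  \<open>a\<close> and \<open>t\<close> are 1, \<open>b\<close> and \<open>s\<close> are 0.\<close>

lemma map_p_power:
  assumes "u \<in> carrier M"
  shows "\<gamma> u [^]\<^bsub>M\<^esub> (p ^ (e - 1)) = u [^]\<^bsub>M\<^esub> (p ^ (e - 1))"
  unfolding p_power_M_eq_iff
proof
  have "[int a * int (fst u) = 1 * int (fst u)] (mod int p)"
    using a_cong by (intro cong_mult cong_refl) (simp flip: cong_int_iff)
  then have "[int (fst (\<gamma> u)) = int (fst u)] (mod int p)"
    using cong_trans[OF fst_map_p[OF assms]] by simp
  then show "[fst (\<gamma> u) = fst u] (mod p)" by (simp add: cong_int_iff)
  have "[int b * int (fst u) + int t * int (snd u) = 0 + 1 * int (snd u)] (mod int p)"
    using t_cong p_dvd_b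
    by (intro cong_add cong_mult cong_refl) (simp_all add: cong_0_iff flip: cong_int_iff)
  then have "[int (snd (\<gamma> u)) = int (snd u)] (mod int p)"
    using cong_trans[OF snd_map_p[OF assms]] by simp
  then show "[snd (\<gamma> u) = snd u] (mod p)" by (simp add: cong_int_iff)
qed

end

section \<open>Automorphisms of the embedding\<close>

text \<open>Pigeonhole on \<open>p + 1\<close> indices gives a period \<open>d\<close> with
  \<open>0 < d \<le> p\<close>. If \<open>d < p\<close>, then \<open>d\<close> is coprime to the
  period \<open>p ^ e\<close>, and Bezout makes 1 a period. In both cases \<open>p\<close> is a
  period.\<close>

lemma period_at_most_prime:
  fixes g :: "nat \<Rightarrow> 'a" and p e :: nat
  assumes p: "prime p"
    and shift: "\<And>i j k. g i = g j \<longleftrightarrow> g (i + k) = g (j + k)"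
    and range: "finite (range g)" "card (range g) \<le> p"
    and period: "g (p ^ e) = g 0"
  shows "g p = g 0"
proof -
  have "\<not> inj_on g {..p}"
  proof
    assume "inj_on g {..p}"
    then have "card (g ` {..p}) = Suc p" by (simp add: card_image)
    moreover have "card (g ` {..p}) \<le> card (range g)"
      using range(1) by (intro card_mono) auto
    ultimately show False using range(2) by simp
  qed
  then obtain i j where ij: "i < j" "j \<le> p" "g i = g j"
    unfolding inj_on_def by (metis atMost_iff linorder_neqE_nat)
  define d where "d = j - i"
  have d: "d > 0" "d \<le> p" "g d = g 0"
    using ij shift[of d 0 i] by (auto simp: d_def)
  have mult: "g (l + k * r) = g l" if "g k = g 0" for k l r
  proof (induction r)
    case (Suc r)
    have "g (k + (l + k * r)) = g (0 + (l + k * r))" using that shift by blast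
    then show ?case using Suc by (simp add: algebra_simps)
  qed simp
  show ?thesis
  proof (cases "d = p")
    case False
    with d have "\<not> p dvd d" using dvd_imp_le by fastforce
    then have "coprime d (p ^ e)"
      using p prime_imp_coprime[of p d] by (simp add: coprime_commute)
    then obtain r s where "d * r = p ^ e * s + 1"
      using bezout_nat[of d "p ^ e"] d(1) by auto
    then have "g 1 = g 0"
      using mult[OF d(3), of 0 r] mult[OF period, of 1 s] by (simp add: add.commute)
    then show ?thesis using mult[of 1 0 p] by simp
  qed (use d in simp)
qed

text \<open>The usual notation \<open>inv\<close> is taken by group inverses.\<close>

abbreviation (input) inv_fun :: "('a \<Rightarrow> 'a) \<Rightarrow> 'a \<Rightarrow> 'a" where
  "inv_fun \<equiv> inv_into UNIV"

section \<open>Automorphisms acting on darts, vertices and parts\<close>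

locale regular_multipartite_map =
  fixes D :: "'d set" and R L :: "'d \<Rightarrow> 'd" and \<nu> :: "'d \<Rightarrow> nat \<times> nat" and m n :: nat
  assumes regular: "orientably_regular D R L"
    and underlying: "underlying_Kmn D R L \<nu> m n"
begin

abbreviation "Aut \<equiv> map_aut_set D R L"
abbreviation "G \<equiv> map_aut_group D R L"
abbreviation "H \<equiv> part_preserving D R L \<nu>"

lemma finite_D: "finite D" and R_closed: "d \<in> D \<Longrightarrow> R d \<in> D" and L_closed: "d \<in> D \<Longrightarrow> L d \<in> D"
  and D_nonempty: "D \<noteq> {}"
  using regular unfolding orientably_regular_def is_oriented_map_def by (auto dest: bij_betwE)

lemma vertex_eq_iff: "d \<in> D \<Longrightarrow> d' \<in> D \<Longrightarrow> \<nu> d = \<nu> d' \<longleftrightarrow> (\<exists>k. (R ^^ k) d = d')"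
  using underlying unfolding underlying_Kmn_def by (elim conjE) (drule bspec, assumption)+

lemma vertices: "\<nu> ` D = {0..<m} \<times> {0..<n}"
  using underlying unfolding underlying_Kmn_def by (elim conjE)

lemma part_L: "d \<in> D \<Longrightarrow> fst (\<nu> d) \<noteq> fst (\<nu> (L d))"
  using underlying unfolding underlying_Kmn_def by (elim conjE bspec)

lemma ex1_dart:
  "u \<in> {0..<m} \<times> {0..<n} \<Longrightarrow> w \<in> {0..<m} \<times> {0..<n} \<Longrightarrow> fst u \<noteq> fst w \<Longrightarrow>
    \<exists>!d. d \<in> D \<and> \<nu> d = u \<and> \<nu> (L d) = w"
  using underlying unfolding underlying_Kmn_def by metis

lemma dart_between:
  assumes "d \<in> D" "d' \<in> D" "fst (\<nu> d) \<noteq> fst (\<nu> d')"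
  obtains \<delta> where "\<delta> \<in> D" "\<nu> \<delta> = \<nu> d" "\<nu> (L \<delta>) = \<nu> d'"
  using ex1_dart[of "\<nu> d" "\<nu> d'"] assms vertices by blast

lemma dart_unique:
  assumes "d \<in> D" "d' \<in> D" "\<nu> d = \<nu> d'" "\<nu> (L d) = \<nu> (L d')"
  shows "d = d'"
proof -
  have "\<nu> d \<in> {0..<m} \<times> {0..<n}" "\<nu> (L d) \<in> {0..<m} \<times> {0..<n}"
    using assms L_closed vertices by blast+
  from ex1_dart[OF this part_L] assms show ?thesis by metis
qed

lemma aut_closed: "\<sigma> \<in> Aut \<Longrightarrow> d \<in> D \<Longrightarrow> \<sigma> d \<in> D"
  and aut_R: "\<sigma> \<in> Aut \<Longrightarrow> d \<in> D \<Longrightarrow> \<sigma> (R d) = R (\<sigma> d)"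
  and aut_L: "\<sigma> \<in> Aut \<Longrightarrow> d \<in> D \<Longrightarrow> \<sigma> (L d) = L (\<sigma> d)"
  using bij_betwE[of \<sigma> D D] by (simp_all add: map_aut_set_def)

text \<open>Being the identity off \<open>D\<close> makes an automorphism a bijection of the whole
  type, so \<open>inv_fun\<close> is a genuine two-sided inverse.\<close>

lemma aut_bij: "\<sigma> \<in> Aut \<Longrightarrow> bij \<sigma>"
proof -
  assume "\<sigma> \<in> Aut"
  then have "bij_betw \<sigma> D D" and "\<And>x. x \<in> - D \<Longrightarrow> \<sigma> x = x"
    by (auto simp: map_aut_set_def)
  then have "bij_betw \<sigma> (D \<union> - D) (D \<union> - D)"
    by (intro bij_betw_combine) (auto simp: bij_betw_def inj_on_def)
  then show ?thesis by simp
qed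

lemma aut_id: "id \<in> Aut"
  by (simp add: map_aut_set_def)

lemma aut_comp: "\<sigma> \<in> Aut \<Longrightarrow> \<tau> \<in> Aut \<Longrightarrow> \<sigma> \<circ> \<tau> \<in> Aut"
  using bij_betw_trans[of \<tau> D D \<sigma> D] aut_closed[of \<tau>] by (simp add: map_aut_set_def)

lemma aut_inv_cancel: "\<sigma> \<in> Aut \<Longrightarrow> inv_fun \<sigma> (\<sigma> x) = x" "\<sigma> \<in> Aut \<Longrightarrow> \<sigma> (inv_fun \<sigma> x) = x"
  by (simp_all add: aut_bij bij_is_inj bij_is_surj surj_f_inv_f)

lemma aut_inv:
  assumes \<sigma>: "\<sigma> \<in> Aut"
  shows "inv_fun \<sigma> \<in> Aut"
proof -
  note b = aut_bij[OF \<sigma>]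
  have im: "\<sigma> ` D = D" using \<sigma> by (simp add: map_aut_set_def bij_betw_def)
  have inv_im: "inv_fun \<sigma> ` D = D"
    using b im by (metis bij_def image_inv_f_f)
  have cl: "inv_fun \<sigma> d \<in> D" if "d \<in> D" for d using that inv_im by blast
  have "inv_fun \<sigma> x = x" if "x \<notin> D" for x
  proof -
    have "\<sigma> x = x" using that \<sigma> by (simp add: map_aut_set_def)
    then show ?thesis using aut_inv_cancel(1)[OF \<sigma>, of x] by simp
  qed
  moreover have "inv_fun \<sigma> (R d) = R (inv_fun \<sigma> d)" "inv_fun \<sigma> (L d) = L (inv_fun \<sigma> d)" if "d \<in> D" for d
    using aut_R[OF \<sigma> cl[OF that]] aut_L[OF \<sigma> cl[OF that]]
      aut_inv_cancel(1)[OF \<sigma>, of "R (inv_fun \<sigma> d)"] aut_inv_cancel(1)[OF \<sigma>, of "L (inv_fun \<sigma> d)"]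
    by (simp_all add: aut_inv_cancel(2)[OF \<sigma>])
  moreover have "bij_betw (inv_fun \<sigma>) D D"
    unfolding bij_betw_def
    using inv_im inj_on_subset[OF bij_is_inj[OF bij_imp_bij_inv[OF b]] subset_UNIV] by simp
  ultimately show ?thesis by (simp add: map_aut_set_def)
qed

lemma aut_funpow: "\<sigma> \<in> Aut \<Longrightarrow> \<sigma> ^^ k \<in> Aut"
proof (induction k)
  case 0 show ?case unfolding funpow.simps(1) by (rule aut_id)
next
  case (Suc k) then show ?case unfolding funpow.simps(2) by (intro aut_comp)
qed

lemma carrier_G: "carrier G = Aut" and mult_G: "\<sigma> \<otimes>\<^bsub>G\<^esub> \<tau> = \<sigma> \<circ> \<tau>" and one_G: "\<one>\<^bsub>G\<^esub> = id"
  by (simp_all add: map_aut_group_def)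

lemma group_G: "group G"
proof (rule groupI, unfold carrier_G mult_G one_G)
  show "\<exists>\<tau>\<in>Aut. \<tau> \<circ> \<sigma> = id" if "\<sigma> \<in> Aut" for \<sigma>
    using that aut_inv aut_bij by (metis bij_is_inj inv_o_cancel)
qed (auto simp: aut_id aut_comp comp_assoc)

lemma pow_G: "\<sigma> [^]\<^bsub>G\<^esub> k = \<sigma> ^^ k"
  by (induction k) (simp_all add: one_G mult_G funpow_Suc_right del: funpow.simps(2))

lemma aut_eqI:
  assumes "\<sigma> \<in> Aut" "\<tau> \<in> Aut" "d \<in> D" "\<sigma> d = \<tau> d"
  shows "\<sigma> = \<tau>"
  using regular assms aut_closed unfolding orientably_regular_def by metis

lemma order_G: "order G = card D"
proof -
  obtain d where d: "d \<in> D" using D_nonempty by blast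
  have "bij_betw (\<lambda>\<sigma>. \<sigma> d) Aut D"
    unfolding bij_betw_def
  proof
    show "inj_on (\<lambda>\<sigma>. \<sigma> d) Aut" using aut_eqI d by (auto intro: inj_onI)
    show "(\<lambda>\<sigma>. \<sigma> d) ` Aut = D"
      using d regular aut_closed unfolding orientably_regular_def by fast
  qed
  then show ?thesis by (simp add: order_def carrier_G bij_betw_same_card)
qed

lemma finite_Aut: "finite Aut"
  using order_G finite_D D_nonempty by (metis card_eq_0_iff carrier_G order_def)

text \<open>Darts correspond to ordered pairs of vertices in different parts.\<close>

lemma card_D: "card D = m * n * ((m - 1) * n)"
proof -
  let ?A = "SIGMA u:{0..<m} \<times> {0..<n}. ({0..<m} - {fst u}) \<times> {0..<n}"
  have "bij_betw (\<lambda>d. (\<nu> d, \<nu> (L d))) D ?A"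
    unfolding bij_betw_def
  proof
    show "inj_on (\<lambda>d. (\<nu> d, \<nu> (L d))) D" using dart_unique by (auto intro: inj_onI)
    show "(\<lambda>d. (\<nu> d, \<nu> (L d))) ` D = ?A"
    proof
      show "(\<lambda>d. (\<nu> d, \<nu> (L d))) ` D \<subseteq> ?A"
      proof (rule image_subsetI)
        fix d assume d: "d \<in> D"
        then have "\<nu> d \<in> {0..<m} \<times> {0..<n}" "\<nu> (L d) \<in> {0..<m} \<times> {0..<n}"
          using L_closed vertices by blast+
        then show "(\<nu> d, \<nu> (L d)) \<in> ?A" using part_L[OF d] by (auto simp: mem_Times_iff)
      qed
      show "?A \<subseteq> (\<lambda>d. (\<nu> d, \<nu> (L d))) ` D"
      proof
        fix x assume "x \<in> ?A"
        then obtain u w where x: "x = (u, w)" and u: "u \<in> {0..<m} \<times> {0..<n}"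
          and w: "w \<in> ({0..<m} - {fst u}) \<times> {0..<n}" by blast
        then have "w \<in> {0..<m} \<times> {0..<n}" "fst u \<noteq> fst w" by auto
        then obtain d where "d \<in> D" "\<nu> d = u" "\<nu> (L d) = w" using ex1_dart u by blast
        then show "x \<in> (\<lambda>d. (\<nu> d, \<nu> (L d))) ` D" using x by blast
      qed
    qed
  qed
  then have "card D = card ?A" by (rule bij_betw_same_card)
  also have "\<dots> = (\<Sum>u\<in>{0..<m} \<times> {0..<n}. (m - 1) * n)"
    by (subst card_SigmaI) (auto intro!: sum.cong simp: card_cartesian_product simp del: sum_constant)
  finally show ?thesis by (simp add: card_cartesian_product)
qed

text \<open>Vertices are the orbits of \<open>R\<close>, and automorphisms commute with
  \<open>R\<close>.\<close>

lemma aut_vertex_cong: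
  assumes \<sigma>: "\<sigma> \<in> Aut" and d: "d \<in> D" "d' \<in> D" and "\<nu> d = \<nu> d'"
  shows "\<nu> (\<sigma> d) = \<nu> (\<sigma> d')"
proof -
  obtain k where k: "(R ^^ k) d = d'" using assms vertex_eq_iff by blast
  have "(R ^^ k) d \<in> D \<and> \<sigma> ((R ^^ k) d) = (R ^^ k) (\<sigma> d)" for k
    by (induction k) (auto simp: d R_closed aut_R[OF \<sigma>])
  then have "(R ^^ k) (\<sigma> d) = \<sigma> d'" using k by metis
  then show ?thesis using vertex_eq_iff aut_closed[OF \<sigma>] d by blast
qed

text \<open>Distinct vertices lie in the same part iff they are not adjacent, so automorphisms permute
  the parts.\<close>

lemma aut_part_cong:
  assumes \<sigma>: "\<sigma> \<in> Aut" and d: "d \<in> D" "d' \<in> D" and eq: "fst (\<nu> d) = fst (\<nu> d')"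
  shows "fst (\<nu> (\<sigma> d)) = fst (\<nu> (\<sigma> d'))"
proof (rule ccontr)
  assume "fst (\<nu> (\<sigma> d)) \<noteq> fst (\<nu> (\<sigma> d'))"
  then obtain \<delta> where \<delta>: "\<delta> \<in> D" "\<nu> \<delta> = \<nu> (\<sigma> d)" "\<nu> (L \<delta>) = \<nu> (\<sigma> d')"
    using dart_between aut_closed[OF \<sigma>] d by metis
  let ?\<epsilon> = "inv_fun \<sigma> \<delta>"
  have "\<nu> ?\<epsilon> = \<nu> d" "\<nu> (inv_fun \<sigma> (L \<delta>)) = \<nu> d'"
    using aut_vertex_cong[OF aut_inv[OF \<sigma>], of \<delta> "\<sigma> d"]
      aut_vertex_cong[OF aut_inv[OF \<sigma>], of "L \<delta>" "\<sigma> d'"] \<delta> d L_closed aut_closed[OF \<sigma>]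
    by (auto simp: aut_inv_cancel[OF \<sigma>])
  moreover have "?\<epsilon> \<in> D" "inv_fun \<sigma> (L \<delta>) = L ?\<epsilon>"
    using \<delta> aut_inv[OF \<sigma>] aut_closed aut_L by auto
  ultimately show False using part_L[of ?\<epsilon>] eq by simp
qed

lemma H_subset: "H \<subseteq> Aut" and H_aut: "h \<in> H \<Longrightarrow> h \<in> Aut"
  and H_part: "h \<in> H \<Longrightarrow> d \<in> D \<Longrightarrow> fst (\<nu> (h d)) = fst (\<nu> d)"
  by (auto simp: part_preserving_def)

lemma H_id: "id \<in> H"
  by (simp add: part_preserving_def aut_id)

lemma H_comp: "h \<in> H \<Longrightarrow> k \<in> H \<Longrightarrow> h \<circ> k \<in> H"
  using aut_closed[of k] by (simp add: part_preserving_def aut_comp)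

lemma H_inv:
  assumes "h \<in> H"
  shows "inv_fun h \<in> H"
proof -
  have h: "h \<in> Aut" using assms H_subset by blast
  have "fst (\<nu> (inv_fun h d)) = fst (\<nu> d)" if "d \<in> D" for d
    using H_part[OF assms aut_closed[OF aut_inv[OF h] that]] by (simp add: aut_inv_cancel[OF h])
  then show ?thesis using aut_inv[OF h] by (simp add: part_preserving_def)
qed

lemma H_funpow: "h \<in> H \<Longrightarrow> h ^^ k \<in> H"
proof (induction k)
  case 0 show ?case unfolding funpow.simps(1) by (rule H_id)
next
  case (Suc k) then show ?case unfolding funpow.simps(2) by (intro H_comp)
qed

lemma H_conj:
  assumes c: "c \<in> Aut" and h: "h \<in> H"
  shows "c \<circ> h \<circ> inv_fun c \<in> H"
proof -
  have "fst (\<nu> (c (h (inv_fun c d)))) = fst (\<nu> d)" if "d \<in> D" for d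
  proof -
    have i: "inv_fun c d \<in> D" by (rule aut_closed[OF aut_inv[OF c] that])
    have "fst (\<nu> (c (h (inv_fun c d)))) = fst (\<nu> (c (inv_fun c d)))"
      by (rule aut_part_cong[OF c aut_closed[OF H_aut[OF h] i] i H_part[OF h i]])
    then show ?thesis by (simp add: aut_inv_cancel[OF c])
  qed
  then show ?thesis
    using c H_aut[OF h] by (simp add: part_preserving_def aut_comp aut_inv)
qed

definition vertex_stabilizer :: "'d \<Rightarrow> ('d \<Rightarrow> 'd) set" where
  "vertex_stabilizer d = {h \<in> H. \<nu> (h d) = \<nu> d}"

lemma stabilizer_comp:
  assumes "d \<in> D" "h \<in> vertex_stabilizer d" "k \<in> vertex_stabilizer d"
  shows "h \<circ> k \<in> vertex_stabilizer d"
proof -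
  have "h \<in> Aut" "k \<in> Aut" "\<nu> (k d) = \<nu> d"
    using assms by (simp_all add: vertex_stabilizer_def H_aut)
  then have "\<nu> (h (k d)) = \<nu> (h d)"
    using aut_vertex_cong[OF _ aut_closed[OF _ assms(1)] assms(1)] by blast
  then show ?thesis using assms by (simp add: vertex_stabilizer_def H_comp)
qed

lemma stabilizer_inv:
  assumes "d \<in> D" "h \<in> vertex_stabilizer d"
  shows "inv_fun h \<in> vertex_stabilizer d"
proof -
  have h: "h \<in> Aut" "\<nu> (h d) = \<nu> d" using assms by (simp_all add: vertex_stabilizer_def H_aut)
  have "\<nu> (inv_fun h (h d)) = \<nu> (inv_fun h d)"
    by (rule aut_vertex_cong[OF aut_inv[OF h(1)] aut_closed[OF h(1) assms(1)] assms(1) h(2)])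
  then show ?thesis
    using assms by (simp add: vertex_stabilizer_def H_inv aut_inv_cancel[OF h(1)])
qed

lemma stabilizer_funpow: "d \<in> D \<Longrightarrow> h \<in> vertex_stabilizer d \<Longrightarrow> h ^^ k \<in> vertex_stabilizer d"
proof (induction k)
  case 0 show ?case using H_id by (simp add: vertex_stabilizer_def id_def)
next
  case (Suc k) then show ?case unfolding funpow.simps(2) by (intro stabilizer_comp)
qed

lemma stabilizer_conj:
  assumes d: "d \<in> D" and c: "c \<in> Aut" and h: "h \<in> vertex_stabilizer d"
  shows "c \<circ> h \<circ> inv_fun c \<in> vertex_stabilizer (c d)"
proof -
  have "h \<in> Aut" "\<nu> (h d) = \<nu> d" using h by (simp_all add: vertex_stabilizer_def H_aut)
  then have "\<nu> (c (h d)) = \<nu> (c d)" using aut_vertex_cong[OF c aut_closed[OF _ d] d] by blast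
  then show ?thesis
    using assms by (simp add: vertex_stabilizer_def H_conj aut_inv_cancel)
qed

text \<open>Vertices in different parts are joined by exactly one dart. Fixing both ends fixes that
  dart, and the action on darts is regular.\<close>

lemma stabilizers_trivial_inter:
  assumes d: "d \<in> D" "d' \<in> D" "fst (\<nu> d) \<noteq> fst (\<nu> d')"
    and h: "h \<in> vertex_stabilizer d" "h \<in> vertex_stabilizer d'"
  shows "h = id"
proof -
  have h': "h \<in> Aut" "\<nu> (h d) = \<nu> d" "\<nu> (h d') = \<nu> d'"
    using h by (simp_all add: vertex_stabilizer_def H_aut)
  obtain \<delta> where \<delta>: "\<delta> \<in> D" "\<nu> \<delta> = \<nu> d" "\<nu> (L \<delta>) = \<nu> d'"
    using dart_between d by metis
  have "\<nu> (h \<delta>) = \<nu> \<delta>" "\<nu> (L (h \<delta>)) = \<nu> (L \<delta>)"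
    using aut_vertex_cong[OF h'(1) \<delta>(1) d(1) \<delta>(2)] h' \<delta>
      aut_vertex_cong[OF h'(1) L_closed[OF \<delta>(1)] d(2) \<delta>(3)] aut_L[OF h'(1) \<delta>(1)] by auto
  then have "h \<delta> = \<delta>" using dart_unique[OF aut_closed[OF h'(1) \<delta>(1)] \<delta>(1)] by simp
  then show ?thesis using aut_eqI[OF h'(1) aut_id \<delta>(1)] by simp
qed

text \<open>Orbit-stabilizer as an inequality: the orbit of the vertex under \<open>H\<close> stays
  inside one part of \<open>n\<close> vertices, and translation by an inverse embeds each fibre into
  the stabilizer.\<close>

lemma card_H_le_stabilizer:
  assumes d: "d \<in> D"
  shows "card H \<le> n * card (vertex_stabilizer d)"
proof -
  have fin: "finite H" using finite_Aut H_subset finite_subset by blast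
  have "(\<lambda>h. \<nu> (h d)) ` H \<subseteq> {fst (\<nu> d)} \<times> {0..<n}"
  proof (rule image_subsetI)
    fix h assume h: "h \<in> H"
    have "\<nu> (h d) \<in> {0..<m} \<times> {0..<n}"
      using aut_closed[OF H_aut[OF h] d] vertices by blast
    then show "\<nu> (h d) \<in> {fst (\<nu> d)} \<times> {0..<n}" using H_part[OF h d] by (simp add: mem_Times_iff)
  qed
  then have "card ((\<lambda>h. \<nu> (h d)) ` H) \<le> card ({fst (\<nu> d)} \<times> {0..<n})"
    by (intro card_mono) auto
  then have im: "card ((\<lambda>h. \<nu> (h d)) ` H) \<le> n" by (simp add: card_cartesian_product)
  have fiber: "card {h \<in> H. \<nu> (h d) = u} \<le> card (vertex_stabilizer d)"
    if u: "u \<in> (\<lambda>h. \<nu> (h d)) ` H" for u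
  proof -
    obtain k where k: "k \<in> H" "\<nu> (k d) = u" using u by auto
    then have kA: "k \<in> Aut" using H_subset by blast
    have "inv_fun k \<circ> h \<in> vertex_stabilizer d" if "h \<in> H" "\<nu> (h d) = u" for h
    proof -
      have "\<nu> (inv_fun k (h d)) = \<nu> (inv_fun k (k d))"
        using aut_vertex_cong[OF aut_inv[OF kA] aut_closed[OF H_aut[OF that(1)] d] aut_closed[OF kA d]]
          that(2) k(2) by simp
      then show ?thesis
        using that k by (simp add: vertex_stabilizer_def H_comp H_inv aut_inv_cancel[OF kA])
    qed
    moreover have "inj_on (\<lambda>h. inv_fun k \<circ> h) {h \<in> H. \<nu> (h d) = u}"
      using aut_inv_cancel(2)[OF kA] by (intro inj_onI ext) (metis comp_apply)
    moreover have "finite (vertex_stabilizer d)" using fin by (simp add: vertex_stabilizer_def)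
    ultimately show ?thesis by (intro card_inj_on_le) auto
  qed
  have "card H = (\<Sum>u\<in>(\<lambda>h. \<nu> (h d)) ` H. card {h \<in> H. \<nu> (h d) = u})"
    using fin sum.image_gen[of H "\<lambda>_. 1::nat" "\<lambda>h. \<nu> (h d)"] by simp
  also have "\<dots> \<le> card ((\<lambda>h. \<nu> (h d)) ` H) * card (vertex_stabilizer d)"
    using sum_bounded_above[OF fiber] by simp
  also have "\<dots> \<le> n * card (vertex_stabilizer d)" using im by simp
  finally show ?thesis .
qed

text \<open>The powers of \<open>c\<close> permute the \<open>m\<close> parts with orbits of length
  a power of the prime \<open>m\<close>, hence 1 or \<open>m\<close>; so \<open>c ^^ m\<close> fixes
  every part.\<close>

lemma prime_power_in_H:
  assumes "prime m" and c: "c \<in> Aut" "c ^^ (m ^ e) = id"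
  shows "c ^^ m \<in> H"
proof -
  have "fst (\<nu> ((c ^^ m) d)) = fst (\<nu> d)" if d: "d \<in> D" for d
  proof -
    define g where "g k = fst (\<nu> ((c ^^ k) d))" for k
    have "g m = g 0"
    proof (rule period_at_most_prime[OF \<open>prime m\<close>])
      have "range g \<subseteq> {0..<m}"
      proof
        fix i assume "i \<in> range g"
        then obtain k where "i = fst (\<nu> ((c ^^ k) d))" unfolding g_def by blast
        moreover have "\<nu> ((c ^^ k) d) \<in> {0..<m} \<times> {0..<n}"
          using vertices aut_closed[OF aut_funpow[OF c(1)] d] by blast
        ultimately show "i \<in> {0..<m}" by auto
      qed
      then show "finite (range g)" "card (range g) \<le> m"
        using finite_subset card_mono[of "{0..<m}" "range g"] by auto
      show "g (m ^ e) = g 0" using c by (simp add: g_def)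
      show "g i = g j \<longleftrightarrow> g (i + k) = g (j + k)" for i j k
      proof -
        have a: "c ^^ l \<in> Aut" "(c ^^ l) d \<in> D" for l
          using aut_funpow[OF c(1)] aut_closed[OF aut_funpow[OF c(1)] d] by simp_all
        have s: "(c ^^ (l + k)) d = (c ^^ k) ((c ^^ l) d)" for l
          by (simp add: funpow_add add.commute[of l])
        show ?thesis
          using aut_part_cong[OF a(1)[of k] a(2)[of i] a(2)[of j]]
            aut_part_cong[OF aut_inv[OF a(1)[of k]] a(2)[of "i + k"] a(2)[of "j + k"]]
          unfolding g_def s aut_inv_cancel[OF a(1)] by blast
      qed
    qed
    then show ?thesis by (simp add: g_def)
  qed
  then show ?thesis using aut_funpow[OF c(1)] by (simp add: part_preserving_def)
qed

end

text \<open>For \<open>f = e\<close> the multiplier \<open>1 + p ^ e\<close> is 1 modulo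
  \<open>p ^ e\<close>, and the product is coordinatewise addition.\<close>

lemma metacyclic_group_abelian:
  assumes "a \<in> carrier (metacyclic_group p e e)" "b \<in> carrier (metacyclic_group p e e)"
  shows "a \<otimes>\<^bsub>metacyclic_group p e e\<^esub> b = b \<otimes>\<^bsub>metacyclic_group p e e\<^esub> a"
proof -
  have 1: "[j * (1 + p ^ e) ^ k + l = j + l] (mod p ^ e)" for j k l
  proof -
    have "[1 + p ^ e = 1] (mod p ^ e)" unfolding cong_def by (rule mod_add_self2)
    then have "[(1 + p ^ e) ^ k = 1 ^ k] (mod p ^ e)" by (rule cong_pow)
    then have "[j * (1 + p ^ e) ^ k + l = j * 1 ^ k + l] (mod p ^ e)"
      by (intro cong_add cong_mult cong_refl)
    then show ?thesis by simp
  qed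
  show ?thesis
    using 1[of "snd a" "fst b" "snd b"] 1[of "snd b" "fst a" "snd a"]
    by (cases a; cases b) (simp add: metacyclic_group_def cong_def add.commute)
qed

section \<open>Transfer to the embedding and the final contradiction\<close>

theorem theorem3p6:
  fixes D :: "'d set" and R L :: "'d \<Rightarrow> 'd" and \<nu> :: "'d \<Rightarrow> nat \<times> nat"
    and p e f :: nat and P :: "('d \<Rightarrow> 'd) set"
  assumes "prime p" and "odd p" and "e \<ge> 1"
    and "orientably_regular D R L"
    and "underlying_Kmn D R L \<nu> p (p ^ e)"
    and "f \<in> {1..e}"
    and "(map_aut_group D R L)\<lparr>carrier := part_preserving D R L \<nu>\<rparr> \<cong> metacyclic_group p e f"
    and "\<not> (\<forall>a \<in> part_preserving D R L \<nu>. \<forall>b \<in> part_preserving D R L \<nu>. a \<circ> b = b \<circ> a)"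
    and "sylow_subgroup p P (map_aut_group D R L)"
    and "group_exponent (map_aut_group D R L) P = p ^ e"
  shows "p = 3 \<and> f = e - 1"
proof (rule ccontr)
  assume not_exceptional: "\<not> (p = 3 \<and> f = e - 1)"
  interpret regular_multipartite_map D R L \<nu> p "p ^ e"
    using assms(4,5) by unfold_locales
  define N where "N = p ^ (e - 1)"
  have pN: "p * N = p ^ e" using \<open>e \<ge> 1\<close> unfolding N_def by (cases e) auto
  obtain \<phi> where "\<phi> \<in> iso (G\<lparr>carrier := H\<rparr>) (metacyclic_group p e f)"
    using assms(7) unfolding is_iso_def by blast
  then have \<phi>_mult: "\<And>h k. h \<in> H \<Longrightarrow> k \<in> H \<Longrightarrow> \<phi> (h \<circ> k) = \<phi> h \<otimes>\<^bsub>metacyclic_group p e f\<^esub> \<phi> k"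
    and \<phi>_bij: "bij_betw \<phi> H (carrier (metacyclic_group p e f))"
    by (auto simp: iso_def hom_def mult_G)
  have \<phi>_inj: "h = k" if "h \<in> H" "k \<in> H" "\<phi> h = \<phi> k" for h k
    using \<phi>_bij that by (auto simp: bij_betw_def dest: inj_onD)
  have \<phi>_closed: "\<phi> h \<in> carrier (metacyclic_group p e f)" if "h \<in> H" for h
    using \<phi>_bij that bij_betwE by blast
  have "f \<noteq> e"
  proof
    assume "f = e"
    then have "a \<circ> b = b \<circ> a" if "a \<in> H" "b \<in> H" for a b
      using that metacyclic_group_abelian \<phi>_mult \<phi>_closed by (intro \<phi>_inj) (simp_all add: H_comp)
    then show False using assms(8) by blast
  qed
  then interpret odd_metacyclic p e f
    using assms(1,2,6) by unfold_locales auto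

  have card_H: "card H = p ^ e * p ^ e"
    using bij_betw_same_card[OF \<phi>_bij] by (simp add: metacyclic_group_def card_cartesian_product)
  have finite_H: "finite H" using finite_subset[OF H_subset finite_Aut] .
  have \<phi>_id: "\<phi> id = \<one>\<^bsub>M\<^esub>"
    using \<phi>_mult[OF H_id H_id] by (intro idempotent_M \<phi>_closed H_id) simp
  have \<phi>_pow: "\<phi> (h ^^ k) = \<phi> h [^]\<^bsub>M\<^esub> k" if h: "h \<in> H" for h k
  proof (induction k)
    case 0 show ?case by (simp only: funpow.simps \<phi>_id nat_pow_0)
  next
    case (Suc k)
    then show ?case
      by (simp only: funpow_Suc_right \<phi>_mult[OF H_funpow[OF h] h] nat_pow_Suc)
  qed
  \<comment> \<open>Comparing with the \<open>N\<close>-th power of the identity forces both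
    coordinates to be 0 modulo \<open>p\<close>.\<close>
  have kill: "p dvd fst (\<phi> h) \<and> p dvd snd (\<phi> h)" if "h \<in> H" "h ^^ N = id" for h
  proof -
    have "\<phi> h [^]\<^bsub>M\<^esub> N = (0, 0) [^]\<^bsub>M\<^esub> N"
      using \<phi>_pow[OF that(1), of N] that(2) \<phi>_id by (simp add: one_M pow_M)
    then show ?thesis unfolding N_def p_power_M_eq_iff by (simp add: cong_0_iff)
  qed

  have P: "subgroup P G" "card P = p ^ multiplicity p (order G)"
    using assms(9) by (auto simp: sylow_subgroup_def)
  \<comment> \<open>The group \<open>H\<close> has order \<open>p ^ (2 * e)\<close>, while the
    number \<open>p\<close> of parts contributes one more factor \<open>p\<close> to the order of
    \<open>G\<close>.\<close>
  have "\<not> P \<subseteq> H"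
  proof
    assume "P \<subseteq> H"
    then have "card P \<le> p ^ (e + e)"
      using card_mono[OF finite_H] card_H by (simp add: power_add)
    moreover have "p ^ Suc (e + e) dvd order G"
      unfolding order_G card_D by (simp add: power_add)
    then have "Suc (e + e) \<le> multiplicity p (order G)"
      using prime_p finite_D D_nonempty
      by (intro multiplicity_geI) (auto simp: order_G card_gt_0_iff)
    then have "p ^ Suc (e + e) \<le> card P"
      unfolding P(2) using p_gt_1 by (intro power_increasing) auto
    moreover have "p ^ (e + e) < p ^ Suc (e + e)" using p_gt_1 by simp
    ultimately show False by linarith
  qed
  then obtain c where c: "c \<in> P" "c \<notin> H" by blast
  have cA: "c \<in> Aut" using c(1) P(1) subgroup.subset carrier_G by blast
  have "group.ord G c dvd p ^ e"
    using c(1) assms(10) unfolding group_exponent_def by (metis dvd_Lcm image_eqI)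
  then have "c [^]\<^bsub>G\<^esub> (p ^ e) = \<one>\<^bsub>G\<^esub>"
    using group.pow_eq_id[OF group_G] cA carrier_G by blast
  then have c_pow: "c ^^ (p ^ e) = id" by (simp only: pow_G one_G)
  have cpH: "c ^^ p \<in> H" using prime_power_in_H[OF prime_p cA c_pow] .
  have m_kill: "(c ^^ p) ^^ N = id" by (simp only: funpow_mult pN c_pow mult.commute[of N])

  define \<psi> where "\<psi> = inv_into H \<phi>"
  have \<psi>: "\<psi> u \<in> H" "\<phi> (\<psi> u) = u" if "u \<in> carrier M" for u
    using \<phi>_bij that unfolding \<psi>_def
    by (auto simp: bij_betw_def inv_into_into f_inv_into_f)
  have \<psi>\<phi>: "\<psi> (\<phi> h) = h" if "h \<in> H" for h
    using \<phi>_bij that unfolding \<psi>_def by (simp add: bij_betw_inv_into_left)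
  define conj where "conj h = c \<circ> h \<circ> inv_fun c" for h
  have conj_H: "conj h \<in> H" if "h \<in> H" for h
    unfolding conj_def using H_conj[OF cA that] .
  have conj_comp: "conj (h \<circ> k) = conj h \<circ> conj k" for h k
    by (simp add: conj_def fun_eq_iff aut_inv_cancel[OF cA])
  define \<gamma> where "\<gamma> u = \<phi> (conj (\<psi> u))" for u
  \<comment> \<open>Iterating \<open>\<gamma>\<close> corresponds to conjugation by
    \<open>c ^^ i\<close>, expressed as an intertwining relation so that no inverse of a power has
    to be handled.\<close>
  have iterate: "\<exists>k\<in>H. (\<gamma> ^^ i) (\<phi> h) = \<phi> k \<and> k \<circ> c ^^ i = c ^^ i \<circ> h" if h: "h \<in> H" for h i
  proof (induction i)
    case 0 show ?case using h by (intro bexI[of _ h]) (simp_all add: fun_eq_iff)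
  next
    case (Suc i)
    then obtain k where k: "k \<in> H" "(\<gamma> ^^ i) (\<phi> h) = \<phi> k" "k \<circ> c ^^ i = c ^^ i \<circ> h" by blast
    have "conj k \<circ> (c \<circ> c ^^ i) = c \<circ> (k \<circ> c ^^ i)"
      by (simp add: conj_def fun_eq_iff aut_inv_cancel[OF cA])
    then have "conj k \<circ> c ^^ Suc i = c ^^ Suc i \<circ> h"
      unfolding k(3) by (simp only: funpow.simps comp_assoc)
    moreover have "(\<gamma> ^^ Suc i) (\<phi> h) = \<phi> (conj k)"
      using k by (simp add: \<gamma>_def \<psi>\<phi>)
    ultimately show ?case using conj_H[OF k(1)] by blast
  qed
  interpret metacyclic_inner_power p e f \<gamma> "\<phi> (c ^^ p)"
  proof unfold_locales
    show "\<gamma> u \<in> carrier M" if "u \<in> carrier M" for u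
      using that by (simp add: \<gamma>_def \<phi>_closed conj_H \<psi>)
    show "\<gamma> (u \<otimes>\<^bsub>M\<^esub> v) = \<gamma> u \<otimes>\<^bsub>M\<^esub> \<gamma> v" if uv: "u \<in> carrier M" "v \<in> carrier M" for u v
    proof -
      have "\<phi> (\<psi> u \<circ> \<psi> v) = u \<otimes>\<^bsub>M\<^esub> v" using \<phi>_mult \<psi> uv by simp
      then have "\<psi> (u \<otimes>\<^bsub>M\<^esub> v) = \<psi> u \<circ> \<psi> v" using \<psi>\<phi> H_comp \<psi>(1) uv by metis
      then show ?thesis
        unfolding \<gamma>_def by (simp only: conj_comp \<phi>_mult[OF conj_H conj_H] \<psi> uv)
    qed
    show "p dvd fst (\<phi> (c ^^ p))" "p dvd snd (\<phi> (c ^^ p))"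
      using kill[OF cpH m_kill] by auto
    show "(\<gamma> ^^ p) u \<otimes>\<^bsub>M\<^esub> \<phi> (c ^^ p) = \<phi> (c ^^ p) \<otimes>\<^bsub>M\<^esub> u" if u: "u \<in> carrier M" for u
    proof -
      obtain k where "k \<in> H" "(\<gamma> ^^ p) u = \<phi> k" "k \<circ> c ^^ p = c ^^ p \<circ> \<psi> u"
        using iterate[OF \<psi>(1)[OF u], of p] unfolding \<psi>(2)[OF u] by blast
      then show ?thesis using \<phi>_mult[OF _ cpH, of k] \<phi>_mult[OF cpH \<psi>(1)[OF u]] \<psi>(2)[OF u] by simp
    qed
    show "\<not> (p = 3 \<and> f = e - 1)" by (fact not_exceptional)
  qed
  have conj_pow: "conj h ^^ N = h ^^ N" if h: "h \<in> H" for h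
  proof (rule \<phi>_inj)
    have "\<phi> (conj h) [^]\<^bsub>M\<^esub> N = \<phi> h [^]\<^bsub>M\<^esub> N"
      using map_p_power[OF \<phi>_closed[OF h]] by (simp add: N_def \<gamma>_def \<psi>\<phi>[OF h])
    then show "\<phi> (conj h ^^ N) = \<phi> (h ^^ N)" by (simp only: \<phi>_pow h conj_H)
  qed (auto intro: H_funpow conj_H h)

  obtain d where d: "d \<in> D" "fst (\<nu> (c d)) \<noteq> fst (\<nu> d)"
    using c(2) cA by (auto simp: part_preserving_def)
  define A where "A = vertex_stabilizer d"
  define B where "B = vertex_stabilizer (c d)"
  have cd: "c d \<in> D" using aut_closed[OF cA d(1)] .
  have AB_H: "A \<subseteq> H" "B \<subseteq> H" by (auto simp: A_def B_def vertex_stabilizer_def)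
  have trivial: "h = id" if "h \<in> A" "h \<in> B" for h
    using stabilizers_trivial_inter[OF d(1) cd] d(2) that by (auto simp: A_def B_def)
  \<comment> \<open>Conjugation by \<open>c\<close> carries \<open>A\<close> to \<open>B\<close> but
    preserves \<open>N\<close>-th powers, so \<open>h ^^ N\<close> lies in both stabilizers.\<close>
  have A_kill: "h ^^ N = id" if h: "h \<in> A" for h
  proof (rule trivial)
    show "h ^^ N \<in> A" using stabilizer_funpow[OF d(1)] h by (simp add: A_def)
    have "conj h \<in> B"
      using stabilizer_conj[OF d(1) cA] h by (simp add: A_def B_def conj_def)
    then have "conj h ^^ N \<in> B" using stabilizer_funpow[OF cd] by (simp add: B_def)
    then show "h ^^ N \<in> B" using conj_pow h AB_H by auto
  qed
  have B_kill: "k ^^ N = id" if k: "k \<in> B" for k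
  proof -
    define h where "h = inv_fun c \<circ> k \<circ> inv_fun (inv_fun c)"
    have "h \<in> vertex_stabilizer (inv_fun c (c d))"
      unfolding h_def using k by (intro stabilizer_conj[OF cd aut_inv[OF cA]]) (simp add: B_def)
    then have h: "h \<in> A" by (simp add: A_def aut_inv_cancel[OF cA])
    have "conj h = k"
      by (simp add: conj_def h_def fun_eq_iff aut_inv_cancel[OF cA] inv_inv_eq[OF aut_bij[OF cA]])
    then show ?thesis using conj_pow[of h] A_kill[OF h] h AB_H by auto
  qed
  have card_AB: "p ^ e \<le> card A" "p ^ e \<le> card B"
    using card_H_le_stabilizer[OF d(1)] card_H_le_stabilizer[OF cd] card_H pe_pos
    by (auto simp: A_def B_def)
  \<comment> \<open>Two factorizations of the same element differ by an element of the trivial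
    intersection of \<open>A\<close> and \<open>B\<close>. By counting, the products then exhaust
    \<open>H\<close>.\<close>
  have "inj_on (\<lambda>(h, k). h \<circ> k) (A \<times> B)"
  proof (rule inj_onI, clarify)
    fix h k h' k' assume hk: "h \<in> A" "k \<in> B" "h' \<in> A" "k' \<in> B" and eq: "h \<circ> k = h' \<circ> k'"
    have aut: "h' \<in> Aut" "k \<in> Aut" using hk AB_H H_aut by auto
    have "inv_fun h' \<circ> h = k' \<circ> inv_fun k"
    proof
      fix x
      have "h (k (inv_fun k x)) = h' (k' (inv_fun k x))" using fun_cong[OF eq] by simp
      then show "(inv_fun h' \<circ> h) x = (k' \<circ> inv_fun k) x"
        by (simp add: aut_inv_cancel aut)
    qed
    moreover have "inv_fun h' \<circ> h \<in> A" "k' \<circ> inv_fun k \<in> B"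
      using hk stabilizer_comp stabilizer_inv d(1) cd by (simp_all add: A_def B_def)
    ultimately have "inv_fun h' \<circ> h = id" "k' \<circ> inv_fun k = id" using trivial by auto
    then have "h' (inv_fun h' (h x)) = h' x" "k' (inv_fun k (k x)) = k x" for x
      by (metis comp_apply id_apply)+
    then show "h = h' \<and> k = k'" by (auto simp: aut_inv_cancel aut)
  qed
  then have "card ((\<lambda>(h, k). h \<circ> k) ` (A \<times> B)) = card A * card B"
    by (simp add: card_image card_cartesian_product)
  also have "\<dots> \<ge> card H" unfolding card_H using card_AB by (intro mult_le_mono)
  finally have "(\<lambda>(h, k). h \<circ> k) ` (A \<times> B) = H"
    using AB_H H_comp by (intro card_seteq finite_H) auto
  \<comment> \<open>The generator \<open>x\<close> would be a product of two elements whose first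
    coordinates are divisible by \<open>p\<close>, yet its own first coordinate is 1.\<close>
  then have "\<psi> (1, 0) \<in> (\<lambda>(h, k). h \<circ> k) ` (A \<times> B)" using \<psi>(1) generators_in_M(1) by blast
  then obtain h k where "h \<in> A" "k \<in> B" "\<psi> (1, 0) = h \<circ> k" by auto
  then have hk: "h \<in> A" "k \<in> B" "\<phi> (h \<circ> k) = (1, 0)"
    using \<psi>(2)[OF generators_in_M(1)] by auto
  have "[int (fst (\<phi> h \<otimes>\<^bsub>M\<^esub> \<phi> k)) = int (fst (\<phi> h)) + int (fst (\<phi> k))] (mod int p)"
    by (rule cong_p[OF fst_mult])
  moreover have "\<phi> h \<otimes>\<^bsub>M\<^esub> \<phi> k = (1, 0)" using \<phi>_mult hk AB_H by (metis subsetD)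
  moreover have "p dvd fst (\<phi> h)" "p dvd fst (\<phi> k)"
    using kill A_kill B_kill hk AB_H by blast+
  ultimately have "int p dvd 1" by (metis cong_dvd_iff dvd_add int_dvd_int_iff fst_conv of_nat_1)
  then show False using p_gt_1 by simp
qed

end
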